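(* Let $f:\mathbb{R}\to\mathbb{R}$ be a Borel function, let $r\in(0,2)$, and let $c_n=n^{1/r}h(n)$, $n\ge 1$, where $h$ is a (positive) slowly varying function in the sense of Karamata. Then $$c_n^{-1}\sum_{k=1}^n\Big(f(a_k)-\mathrm{E}\big[f(a_k)I_{[|f(a_k)|\le c_n]}\big]\Big)\longrightarrow 0\ \text{ in } \mathrm{P}\text{-probability}$$ if and only if $$n\,\mathrm{P}[|f(a_1)|>c_n]\to 0\quad\text{as } n\to\infty .$$
   Context: For irrational $x\in(0,1]$, $a_n(x)\in\mathbb{N}=\{1,2,\ldots\}$, $n\ge1$, denote the partial quotients (digits) of the simple non-terminating continued fraction expansion $x=\cfrac{1}{a_1(x)+\cfrac{1}{a_2(x)+\cdots}}$. The sequence $\{a_n\}$ is regarded as a random sequence on the probability space $((0,1],\mathcal{B},\mathrm{P})$, where $\mathcal{B}$ is the Borel $\sigma$-field of $(0,1]$ and $\mathrm{P}$ is the Gauss measure $\mathrm{P}(A)=\frac{1}{\ln 2}\int_A\frac{dx}{1+x}$. $\mathrm{E}$ denotes expectation with respect to $\mathrm{P}$ and $I_{[\cdot]}$ the indicator of an event. A positive measurable function $h$ is slowly varying in the sense of Karamata if $h(\lambda x)/h(x)\to1$ as $x\to\infty$ for every $\lambda>0$. *)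

theory Defs
  imports "HOL-Probability.Probability"
begin

fun cf_convergent :: "(nat \<Rightarrow> nat) \<Rightarrow> nat \<Rightarrow> real" where
  "cf_convergent s 0 = 0"
| "cf_convergent s (Suc n) = 1 / (real (s 0) + cf_convergent (\<lambda>i. s (Suc i)) n)"

definition has_cf_expansion :: "real \<Rightarrow> (nat \<Rightarrow> nat) \<Rightarrow> bool" where
  "has_cf_expansion x s \<longleftrightarrow> (\<forall>i. 1 \<le> s i) \<and> cf_convergent s \<longlonglongrightarrow> x"

text \<open>
  The digits are numbered \<open>n = 1, 2, \<dots>\<close>, whereas the sequence in
  \<^const>\<open>has_cf_expansion\<close> starts at \<open>0\<close>. The value at rational \<open>x\<close> (a null set) is
  a dummy; the one at \<open>n = 0\<close> is never used. Existence and uniqueness of the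
  expansion of an irrational number in \<open>(0, 1]\<close> are shown in \<open>ex1_cf_expansion\<close> below.
\<close>

definition cf_digit :: "nat \<Rightarrow> real \<Rightarrow> nat" where
  "cf_digit n x = (if x \<in> {0<..1} - \<rat> then (THE s. has_cf_expansion x s) (n - 1) else 0)"

definition gauss_measure :: "real measure" where
  "gauss_measure =
     density (restrict_space lborel {0<..1}) (\<lambda>x. ennreal (1 / (ln 2 * (1 + x))))"

definition slowly_varying :: "(real \<Rightarrow> real) \<Rightarrow> bool" where
  "slowly_varying h \<longleftrightarrow>
     (\<forall>x>0. h x > 0) \<and>
     h \<in> borel_measurable (restrict_space borel {0<..}) \<and>
     (\<forall>u>0. ((\<lambda>x. h (u * x) / h x) \<longlongrightarrow> 1) at_top)"

definition tendsto_in_prob ::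
    "'a measure \<Rightarrow> (nat \<Rightarrow> 'a \<Rightarrow> real) \<Rightarrow> real \<Rightarrow> bool" where
  "tendsto_in_prob M X l \<longleftrightarrow>
     (\<forall>\<epsilon>>0. (\<lambda>n. measure M {\<omega> \<in> space M. \<bar>X n \<omega> - l\<bar> > \<epsilon>}) \<longlonglongrightarrow> 0)"

lemma cf_convergent_bounds:
  assumes "\<forall>i. 1 \<le> s i"
  shows "0 \<le> cf_convergent s n" "cf_convergent s n \<le> 1"
proof -
  have "0 \<le> cf_convergent s n \<and> cf_convergent s n \<le> 1"
    using assms
  proof (induction n arbitrary: s)
    case (Suc n)
    have "0 \<le> cf_convergent (\<lambda>i. s (Suc i)) n" using Suc by simp
    moreover have "1 \<le> real (s 0)" using Suc.prems by (metis of_nat_1 of_nat_le_iff)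
    ultimately show ?case by simp
  qed simp
  then show "0 \<le> cf_convergent s n" "cf_convergent s n \<le> 1" by auto
qed

lemma cf_contraction:
  fixes a b y z :: real
  assumes "1 \<le> a" "1 \<le> b" "0 \<le> y" "0 \<le> z"
  shows "\<bar>1 / (a + 1 / (b + y)) - 1 / (a + 1 / (b + z))\<bar> \<le> \<bar>y - z\<bar> / 4"
proof -
  define u v where "u = a * (b + y) + 1" and "v = a * (b + z) + 1"
  have ge: "1 \<le> a * (b + y)" "1 \<le> a * (b + z)"
    using assms mult_mono[of 1 a 1 "b + y"] mult_mono[of 1 a 1 "b + z"] by auto
  have uv: "2 \<le> u" "2 \<le> v" using ge by (auto simp: u_def v_def)
  have "1 / (a + 1 / (b + y)) = (b + y) / u" "1 / (a + 1 / (b + z)) = (b + z) / v"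
    using assms by (auto simp: u_def v_def field_simps)
  moreover have "(b + y) / u - (b + z) / v = (y - z) / (u * v)"
  proof -
    have "(b + y) / u - (b + z) / v = ((b + y) * v - (b + z) * u) / (u * v)"
      using uv by (simp add: diff_frac_eq mult.commute)
    also have "(b + y) * v - (b + z) * u = y - z"
      by (simp add: u_def v_def algebra_simps)
    finally show ?thesis .
  qed
  moreover have "\<bar>(y - z) / (u * v)\<bar> \<le> \<bar>y - z\<bar> / 4"
  proof -
    have "4 \<le> u * v" using uv mult_mono[of 2 u 2 v] by simp
    then have "\<bar>y - z\<bar> / (u * v) \<le> \<bar>y - z\<bar> / 4" by (intro divide_left_mono) auto
    then show ?thesis using uv by (simp add: abs_mult)
  qed
  ultimately show ?thesis by simp
qed

definition gauss_map :: "real \<Rightarrow> real" where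
  "gauss_map x = frac (1 / x)"

definition gauss_digits :: "real \<Rightarrow> nat \<Rightarrow> nat" where
  "gauss_digits x i = nat \<lfloor>1 / (gauss_map ^^ i) x\<rfloor>"

lemma gauss_map_irrational:
  assumes "x \<in> {0<..1} - \<rat>"
  shows "gauss_map x \<in> {0<..1} - \<rat>"
proof -
  have "1 / x \<notin> \<rat>" using assms by (metis DiffD2 Rats_inverse inverse_eq_divide inverse_inverse_eq)
  moreover have "frac (1 / x) \<noteq> 0"
    using calculation by (auto simp: frac_eq_0_iff Ints_subset_Rats[THEN subsetD])
  moreover have "frac (1 / x) \<notin> \<rat>"
  proof
    assume "frac (1 / x) \<in> \<rat>"
    then have "frac (1 / x) + of_int \<lfloor>1 / x\<rfloor> \<in> \<rat>" by (rule Rats_add) simp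
    then show False using \<open>1 / x \<notin> \<rat>\<close> by (simp add: frac_def)
  qed
  ultimately show ?thesis
    by (auto simp: gauss_map_def order_less_le less_imp_le[OF frac_lt_1])
qed

lemma gauss_digits_Suc: "gauss_digits x (Suc i) = gauss_digits (gauss_map x) i"
  by (simp add: gauss_digits_def funpow_swap1)

lemma gauss_digits_0:
  assumes "x \<in> {0<..1} - \<rat>"
  shows "real (gauss_digits x 0) = 1 / x - gauss_map x"
  using assms by (simp add: gauss_digits_def gauss_map_def frac_def)

lemma gauss_digits_ge_1:
  assumes "x \<in> {0<..1} - \<rat>"
  shows "1 \<le> gauss_digits x i"
  using assms
proof (induction i arbitrary: x)
  case 0
  then have "1 \<le> 1 / x" by auto
  then have "1 \<le> \<lfloor>1 / x\<rfloor>" by linarith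
  then show ?case unfolding gauss_digits_def funpow_0 by linarith
next
  case (Suc i)
  then show ?case using gauss_map_irrational by (simp add: gauss_digits_Suc)
qed

lemma gauss_digits_error:
  assumes "x \<in> {0<..1} - \<rat>"
  shows "\<bar>cf_convergent (gauss_digits x) n - x\<bar> \<le> (1 / 4) ^ (n div 2)"
  using assms
proof (induction n arbitrary: x rule: induct_nat_012)
  case (ge2 n)
  define y z where "y = gauss_map x" and "z = gauss_map y"
  have y: "y \<in> {0<..1} - \<rat>" and z: "z \<in> {0<..1} - \<rat>"
    unfolding y_def z_def using ge2.prems by (intro gauss_map_irrational; simp)+
  define a b where "a = real (gauss_digits x 0)" and "b = real (gauss_digits y 0)"
  have a: "1 \<le> a" and b: "1 \<le> b"
    using gauss_digits_ge_1[OF ge2.prems, of 0] gauss_digits_ge_1[OF y, of 0]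
    by (simp_all add: a_def b_def)
  have "x = 1 / (a + y)" "y = 1 / (b + z)"
    using gauss_digits_0[OF ge2.prems] gauss_digits_0[OF y]
    by (simp_all add: a_def b_def y_def z_def)
  then have x: "x = 1 / (a + 1 / (b + z))" by simp
  have "cf_convergent (gauss_digits x) (Suc (Suc n)) =
      1 / (a + 1 / (b + cf_convergent (gauss_digits z) n))"
    by (simp add: a_def b_def gauss_digits_Suc y_def z_def)
  then have "\<bar>cf_convergent (gauss_digits x) (Suc (Suc n)) - x\<bar> \<le>
      \<bar>cf_convergent (gauss_digits z) n - z\<bar> / 4"
    using cf_contraction[OF a b, of "cf_convergent (gauss_digits z) n" z] x z
      cf_convergent_bounds(1)[of "gauss_digits z" n] gauss_digits_ge_1[OF z] by simp
  also have "\<dots> \<le> (1 / 4) ^ (n div 2) / 4" using ge2.IH(1)[OF z] by simp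
  finally show ?case by simp
next
  case 1
  then have "cf_convergent (gauss_digits x) (Suc 0) \<in> {0..1}"
    using cf_convergent_bounds[of "gauss_digits x" "Suc 0"] gauss_digits_ge_1 by auto
  with 1 show ?case by (auto simp del: cf_convergent.simps)
qed auto

lemma has_cf_expansion_gauss_digits:
  assumes "x \<in> {0<..1} - \<rat>"
  shows "has_cf_expansion x (gauss_digits x)"
proof -
  have "filterlim (\<lambda>n::nat. n div 2) at_top at_top"
    unfolding filterlim_at_top eventually_sequentially
    by (metis div_le_mono nonzero_mult_div_cancel_left zero_neq_numeral)
  then have "(\<lambda>n. (1 / 4 :: real) ^ (n div 2)) \<longlonglongrightarrow> 0"
    by (rule filterlim_compose[OF LIMSEQ_realpow_zero, rotated 2]) auto
  then have "(\<lambda>n. cf_convergent (gauss_digits x) n - x) \<longlonglongrightarrow> 0"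
    by (rule Lim_null_comparison[rotated]) (use gauss_digits_error[OF assms] in auto)
  then show ?thesis
    using gauss_digits_ge_1[OF assms] LIM_zero_iff by (auto simp: has_cf_expansion_def)
qed

lemma has_cf_expansion_step:
  assumes "has_cf_expansion x s" "x \<in> {0<..1} - \<rat>"
  shows "s 0 = gauss_digits x 0" "has_cf_expansion (gauss_map x) (\<lambda>i. s (Suc i))"
proof -
  define t where "t = (\<lambda>i. s (Suc i))"
  have s: "\<forall>i. 1 \<le> s i" and lim: "cf_convergent s \<longlonglongrightarrow> x"
    using assms(1) by (auto simp: has_cf_expansion_def)
  have t: "\<forall>i. 1 \<le> t i" using s by (simp add: t_def)
  have "(\<lambda>n. 1 / cf_convergent s (Suc n) - real (s 0)) \<longlonglongrightarrow> 1 / x - real (s 0)"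
    using assms(2) LIMSEQ_Suc[OF lim] by (intro tendsto_intros) auto
  then have lim': "cf_convergent t \<longlonglongrightarrow> 1 / x - real (s 0)"
    by (simp add: t_def)
  have "0 \<le> 1 / x - real (s 0)" "1 / x - real (s 0) \<le> 1"
    using LIMSEQ_le_const[OF lim'] LIMSEQ_le_const2[OF lim'] cf_convergent_bounds[OF t]
    by blast+
  moreover have "1 / x - real (s 0) \<noteq> 1"
  proof
    assume "1 / x - real (s 0) = 1"
    then have "1 / x = of_nat (Suc (s 0))" by simp
    then have "x = 1 / of_nat (Suc (s 0))" using assms(2) by (simp add: field_simps)
    moreover have "1 / of_nat (Suc (s 0)) \<in> (\<rat> :: real set)"
      by (intro Rats_divide Rats_1 Rats_of_nat)
    ultimately show False using assms(2) by simp
  qed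
  ultimately have fl: "\<lfloor>1 / x\<rfloor> = int (s 0)" by (intro floor_unique) auto
  then show "s 0 = gauss_digits x 0" by (simp add: gauss_digits_def)
  have "1 / x - real (s 0) = gauss_map x" using fl by (simp add: gauss_map_def frac_def)
  then show "has_cf_expansion (gauss_map x) (\<lambda>i. s (Suc i))"
    using lim' t by (simp add: has_cf_expansion_def t_def)
qed

lemma has_cf_expansion_unique:
  assumes "has_cf_expansion x s" "x \<in> {0<..1} - \<rat>"
  shows "s = gauss_digits x"
proof
  fix i show "s i = gauss_digits x i"
    using assms
  proof (induction i arbitrary: x s)
    case 0
    then show ?case by (rule has_cf_expansion_step(1))
  next
    case (Suc i)
    show ?case
      using Suc.IH[OF has_cf_expansion_step(2)[OF Suc.prems] gauss_map_irrational[OF Suc.prems(2)]]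
      by (simp add: gauss_digits_Suc)
  qed
qed

lemma ex1_cf_expansion:
  assumes "x \<in> {0<..1} - \<rat>"
  shows "\<exists>!s. has_cf_expansion x s"
  using has_cf_expansion_gauss_digits[OF assms] has_cf_expansion_unique[OF _ assms] by blast

lemma cf_digit_eq_gauss_digits:
  assumes "x \<in> {0<..1} - \<rat>"
  shows "cf_digit n x = gauss_digits x (n - 1)"
proof -
  have "(THE s. has_cf_expansion x s) = gauss_digits x"
    using has_cf_expansion_gauss_digits[OF assms] has_cf_expansion_unique[OF _ assms]
    by (rule the_equality)
  then show ?thesis using assms by (simp add: cf_digit_def)
qed

lemma prob_space_gauss_measure: "prob_space gauss_measure"
proof
  let ?g = "\<lambda>x::real. ennreal (1 / (ln 2 * (1 + x)))"
  have g: "?g \<in> borel_measurable (restrict_space lborel {0<..1})"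
    by (intro measurable_restrict_space1) auto
  have "emeasure gauss_measure (space gauss_measure) =
      (\<integral>\<^sup>+x. ?g x * indicator (space (restrict_space lborel {0<..1})) x
        \<partial>restrict_space lborel {0<..1})"
    unfolding gauss_measure_def space_density by (rule emeasure_density[OF g sets.top])
  also have "\<dots> = (\<integral>\<^sup>+x. ?g x \<partial>restrict_space lborel {0<..1})"
    by (intro nn_integral_cong) auto
  also have "\<dots> = (\<integral>\<^sup>+x. ?g x * indicator {0<..1} x \<partial>lborel)"
    by (intro nn_integral_restrict_space) auto
  also have "\<dots> = (\<integral>\<^sup>+x. ?g x * indicator {0..1} x \<partial>lborel)"
    by (intro nn_integral_cong_AE eventually_mono[OF AE_lborel_singleton[of 0]])
      (simp add: indicator_def)
  also have "\<dots> = ennreal (ln (1 + 1) / ln 2 - ln (1 + 0) / ln 2)"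
  proof (rule nn_integral_FTC_Icc[where F = "\<lambda>x. ln (1 + x) / ln 2"])
    fix x :: real assume "x \<in> {0..1}"
    then show "((\<lambda>x. ln (1 + x) / ln 2) has_real_derivative 1 / (ln 2 * (1 + x))) (at x)"
      by (auto intro!: derivative_eq_intros)
  qed auto
  finally show "emeasure gauss_measure (space gauss_measure) = 1" by simp
qed

end

theory Submission
  imports Defs
begin

text \<open>
  Sufficiency: truncate at \<open>c n\<close> and apply Chebyshev's inequality. The variance of a digit sum is
  linear in \<open>n\<close> because the transfer operator of the Gauss map turns an increasing function into
  a decreasing one with at most half the oscillation, so that covariances decay exponentially.
  The truncated second moment \<open>m n\<close> satisfies \<open>m n \<le> m k + (c n)\<^sup>2 P(|f a\<^sub>1| > c k)\<close>; for
  \<open>k = \<lceil>n / 2\<rceil>\<close> and \<open>r < 2\<close> this is a contracting recursion for \<open>n (m n) / (c n)\<^sup>2\<close>.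

  Necessity: replacing one moderate digit by a digit with \<open>|f a\<^sub>k| > c n\<close> throws the sum off its
  centering, and by bounded distortion this costs only the probability of the large digit. Hence
  the expected number of large digits on the event that the sum deviates is of order
  \<open>n P(|f a\<^sub>1| > c n)\<close>, which a second moment bound turns into a lower bound for the probability
  of a deviation.
\<close>

subsection \<open>The Gauss map and its transfer operator\<close>

text \<open>Since the truncation level grows with \<open>n\<close>, a covariance bound in terms of
  the supremum of the truncated function would be useless; it has to be in terms of its moments.
  Therefore decorrelation is measured against the L1 norm of the second factor, and the branch
  weights are shown to be Lipschitz with constants proportional to the weights themselves. A
  function of one digit is not monotone in \<open>x\<close>, so the decorrelation estimate is
  reached only after one step of the transfer operator. Slow variation concerns one fixed ratio at a
  time and \<open>c\<close> need not be monotone, whereas the ratio of \<open>n\<close> to the upper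
  half of \<open>n\<close> depends on the parity of \<open>n\<close>. This is why convergence
  uniform over ratios in [1, 2] is proved first. For necessity, two digit strings that differ in one
  place have sums that differ by that digit alone, whatever the centering. Comparing their
  probabilities replaces the usual appeal to independence.\<close>

lemma measurable_gauss_map [measurable]: "gauss_map \<in> borel_measurable borel"
  unfolding gauss_map_def frac_def by measurable

lemma measurable_gauss_map_funpow [measurable]: "gauss_map ^^ n \<in> borel_measurable borel"
proof (induction n)
  case (Suc n)
  then show ?case
    using measurable_comp[OF Suc measurable_gauss_map] by simp
qed (simp add: id_def)

lemma measurable_gauss_digits [measurable]:
  "(\<lambda>x. gauss_digits x n) \<in> measurable borel (count_space UNIV)"
proof -
  have [measurable]: "(\<lambda>x. (gauss_map ^^ n) x) \<in> borel_measurable borel"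
    using measurable_gauss_map_funpow .
  show ?thesis unfolding gauss_digits_def by measurable
qed

text \<open>Branches are indexed from 0, so branch \<open>j\<close> carries the digit
  \<open>Suc j\<close>. At \<open>y = 1\<close> the floor would be one larger; the identities that
  go through this lemma are therefore stated on the open interval or almost everywhere.\<close>

lemma gauss_branch:
  assumes "y \<in> {0<..<1}"
  shows "gauss_map (1 / (y + real (Suc j))) = y" "gauss_digits (1 / (y + real (Suc j))) 0 = Suc j"
proof -
  have "\<lfloor>y + real (Suc j)\<rfloor> = int (Suc j)"
    using assms by (intro floor_unique) auto
  then show "gauss_map (1 / (y + real (Suc j))) = y" "gauss_digits (1 / (y + real (Suc j))) 0 = Suc j"
    by (simp_all add: gauss_map_def gauss_digits_def frac_def)
qed

lemma nn_integral_branch: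
  fixes F :: "real \<Rightarrow> ennreal"
  assumes [measurable]: "F \<in> borel_measurable borel"
  shows "(\<integral>\<^sup>+x. F x * indicator {1 / (real j + 2)<..1 / (real j + 1)} x \<partial>lborel) =
    (\<integral>\<^sup>+y. F (1 / (y + real (Suc j))) * ennreal (1 / (y + real (Suc j))^2) *
      indicator {0<..<1} y \<partial>lborel)"
proof -
  \<comment> \<open>The branch is decreasing, while the substitution rule wants an increasing map.
    Hence the parametrisation by \<open>t = 1 - y\<close>, undone below by a reflection.\<close>
  let ?g = "\<lambda>t. 1 / (real j + 2 - t)"
  let ?g' = "\<lambda>t. 1 / (real j + 2 - t)^2"
  have "(\<integral>\<^sup>+x. F x * indicator {1 / (real j + 2)<..1 / (real j + 1)} x \<partial>lborel)
      = (\<integral>\<^sup>+x. F x * indicator {?g 0..?g 1} x \<partial>lborel)"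
    by (intro nn_integral_cong_AE eventually_mono[OF AE_lborel_singleton[of "1 / (real j + 2)"]])
      (auto simp: indicator_def add.commute)
  also have "\<dots> = (\<integral>\<^sup>+t. F (?g t) * ?g' t * indicator {0..1} t \<partial>lborel)"
  proof (rule nn_integral_substitution_aux)
    fix t :: real assume "t \<in> {0..1}"
    then show "(?g has_real_derivative ?g' t) (at t)"
      by (auto intro!: derivative_eq_intros simp: power2_eq_square)
  qed (auto intro!: continuous_intros)
  also have "\<dots> = (\<integral>\<^sup>+y. F (?g (1 + (-1) * y)) * ?g' (1 + (-1) * y) * indicator {0..1} (1 + (-1) * y) \<partial>lborel)"
    by (subst nn_integral_real_affine[where c = "-1" and t = 1]) (auto simp: nn_integral_cmult)
  also have "\<dots> = (\<integral>\<^sup>+y. F (1 / (y + real (Suc j))) * ennreal (1 / (y + real (Suc j))^2) *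
      indicator {0<..<1} y \<partial>lborel)"
  proof (intro nn_integral_cong_AE eventually_mono[OF eventually_conj[OF AE_lborel_singleton[of 0] AE_lborel_singleton[of 1]]])
    fix y :: real assume "y \<noteq> 0 \<and> y \<noteq> 1"
    then show "F (?g (1 + (-1) * y)) * ?g' (1 + (-1) * y) * indicator {0..1} (1 + (-1) * y) =
      F (1 / (y + real (Suc j))) * ennreal (1 / (y + real (Suc j))^2) * indicator {0<..<1} y"
      by (auto simp: indicator_def algebra_simps)
  qed
  finally show ?thesis .
qed

text \<open>The intervals on which the first digit is \<open>Suc j\<close> partition the unit
  interval; only the point 1, which belongs to the interval of \<open>j = 0\<close>, has to be
  discarded. On each interval the inverse branch is substituted.\<close>

lemma nn_integral_branches:
  fixes F :: "real \<Rightarrow> ennreal"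
  assumes [measurable]: "F \<in> borel_measurable borel"
  shows "(\<integral>\<^sup>+x. F x * indicator {0<..<1} x \<partial>lborel) =
    (\<integral>\<^sup>+y. (\<Sum>j. F (1 / (y + real (Suc j))) * ennreal (1 / (y + real (Suc j))^2)) *
      indicator {0<..<1} y \<partial>lborel)"
proof -
  let ?J = "\<lambda>j. {1 / (real j + 2)<..1 / (real j + 1)}"
  have disj: "disjoint_family ?J"
    unfolding disjoint_family_on_def
  proof (intro ballI impI)
    have *: "?J m \<inter> ?J n = {}" if "m < n" for m n :: nat
    proof -
      have "1 / (real n + 1) \<le> 1 / (real m + 2)"
        using that by (intro divide_left_mono) auto
      then show ?thesis by auto
    qed
    fix m n :: nat assume "m \<noteq> n"
    then show "?J m \<inter> ?J n = {}" using *[of m n] *[of n m] by (cases "m < n") auto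
  qed
  have "(\<integral>\<^sup>+x. F x * indicator {0<..<1} x \<partial>lborel) =
      (\<integral>\<^sup>+x. (\<Sum>j. F x * indicator (?J j) x) \<partial>lborel)"
  proof (intro nn_integral_cong_AE eventually_mono[OF AE_lborel_singleton[of 1]])
    fix x :: real assume x: "x \<noteq> 1"
    show "F x * indicator {0<..<1} x = (\<Sum>j. F x * indicator (?J j) x)"
    proof (cases "x \<in> {0<..<1}")
      case True
      define j where "j = nat (\<lfloor>1 / x\<rfloor> - 1)"
      have "1 \<le> 1 / x" using True by simp
      then have "1 \<le> \<lfloor>1 / x\<rfloor>" by linarith
      then have "of_int \<lfloor>1 / x\<rfloor> = real j + 1" by (simp add: j_def)
      then have "real j + 1 \<le> 1 / x" "1 / x < real j + 2" by linarith+
      then have "x \<in> ?J j" using True by (simp add: field_simps)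
      from suminf_cmult_indicator[OF disj this, of "\<lambda>_. F x"] True show ?thesis by simp
    next
      case False
      have "x \<notin> ?J j" for j
      proof
        assume *: "x \<in> ?J j"
        have "1 / (real j + 1) \<le> 1" by simp
        moreover have "0 < 1 / (real j + 2)" by simp
        moreover have "1 / (real j + 2) < x" "x \<le> 1 / (real j + 1)" using * by auto
        ultimately have "0 < x" "x \<le> 1" by linarith+
        then show False using False x by auto
      qed
      then have "(\<Sum>j. F x * indicator (?J j) x) = (\<Sum>j. 0)"
        by (intro arg_cong[where f = suminf] ext) (simp add: indicator_def)
      then show ?thesis using False by simp
    qed
  qed
  also have "\<dots> = (\<Sum>j. \<integral>\<^sup>+x. F x * indicator (?J j) x \<partial>lborel)"
    by (rule nn_integral_suminf) measurable
  also have "\<dots> = (\<Sum>j. \<integral>\<^sup>+y. F (1 / (y + real (Suc j))) * ennreal (1 / (y + real (Suc j))^2) *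
      indicator {0<..<1} y \<partial>lborel)"
    by (simp only: nn_integral_branch[OF assms])
  also have "\<dots> = (\<integral>\<^sup>+y. (\<Sum>j. F (1 / (y + real (Suc j))) * ennreal (1 / (y + real (Suc j))^2) *
      indicator {0<..<1} y) \<partial>lborel)"
    by (rule nn_integral_suminf[symmetric]) measurable
  finally show ?thesis by simp
qed

section \<open>The Gauss measure\<close>

abbreviation "\<gamma> \<equiv> gauss_measure"

lemma sets_gauss_measure [measurable_cong]: "sets \<gamma> = sets (restrict_space borel {0<..1})"
  unfolding gauss_measure_def by (simp add: sets_restrict_space)

lemma space_gauss_measure: "space \<gamma> = {0<..1}"
  unfolding gauss_measure_def by simp

lemma measurable_gauss_measure: "F \<in> measurable borel N \<Longrightarrow> F \<in> measurable \<gamma> N"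
  by (subst measurable_cong_sets[OF sets_gauss_measure refl]) (rule measurable_restrict_space1)

lemma nn_integral_gauss_measure:
  fixes F :: "real \<Rightarrow> ennreal"
  assumes [measurable]: "F \<in> borel_measurable borel"
  shows "(\<integral>\<^sup>+x. F x \<partial>\<gamma>) = (\<integral>\<^sup>+x. ennreal (1 / (ln 2 * (1 + x))) * F x * indicator {0<..<1} x \<partial>lborel)"
proof -
  have "(\<integral>\<^sup>+x. F x \<partial>\<gamma>) = (\<integral>\<^sup>+x. ennreal (1 / (ln 2 * (1 + x))) * F x \<partial>restrict_space lborel {0<..1})"
    unfolding gauss_measure_def by (intro nn_integral_density measurable_restrict_space1) auto
  also have "\<dots> = (\<integral>\<^sup>+x. ennreal (1 / (ln 2 * (1 + x))) * F x * indicator {0<..1} x \<partial>lborel)"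
    by (intro nn_integral_restrict_space) auto
  also have "\<dots> = (\<integral>\<^sup>+x. ennreal (1 / (ln 2 * (1 + x))) * F x * indicator {0<..<1} x \<partial>lborel)"
    by (intro nn_integral_cong_AE eventually_mono[OF AE_lborel_singleton[of 1]])
      (auto simp: indicator_def)
  finally show ?thesis .
qed

lemma AE_gauss_measureI:
  assumes "AE x in lborel. x \<in> {0<..1} \<longrightarrow> P x"
  shows "AE x in \<gamma>. P x"
  unfolding gauss_measure_def
proof (subst AE_density)
  show "AE x in restrict_space lborel {0<..1}. 0 < ennreal (1 / (ln 2 * (1 + x))) \<longrightarrow> P x"
    using assms by (subst AE_restrict_space_iff) auto
qed (intro measurable_restrict_space1, auto)

lemma AE_gauss_irrational: "AE x in \<gamma>. x \<in> {0<..<1} - \<rat>"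
proof (rule AE_gauss_measureI)
  have "\<rat> \<in> null_sets (lborel :: real measure)"
    by (intro countable_imp_null_set_lborel countable_rat)
  from AE_not_in[OF this] show "AE x in lborel. x \<in> {0<..1} \<longrightarrow> x \<in> {0<..<1} - (\<rat>::real set)"
  proof (rule eventually_mono)
    fix x :: real assume "x \<notin> \<rat>"
    then have "x \<noteq> 1" by auto
    with \<open>x \<notin> \<rat>\<close> show "x \<in> {0<..1} \<longrightarrow> x \<in> {0<..<1} - \<rat>" by auto
  qed
qed

text \<open>The conditional probability, under the Gauss measure, that the first digit is
  \<open>Suc i\<close> given that \<open>gauss_map x = y\<close>.\<close>

definition branch_prob :: "nat \<Rightarrow> real \<Rightarrow> real" where
  "branch_prob i y = (1 + y) / ((y + real i + 1) * (y + real i + 2))"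

text \<open>The Perron-Frobenius operator of the Gauss map normalised by the Gauss density, that is,
  the conditional expectation of \<open>v x\<close> given \<open>gauss_map x = y\<close>.\<close>

definition transfer :: "(real \<Rightarrow> real) \<Rightarrow> real \<Rightarrow> real" where
  "transfer v y = (\<Sum>i. branch_prob i y * v (1 / (y + real (Suc i))))"

lemma measurable_branch_prob [measurable]: "branch_prob i \<in> borel_measurable borel"
  unfolding branch_prob_def by measurable

lemma measurable_transfer [measurable]:
  assumes [measurable]: "v \<in> borel_measurable borel"
  shows "transfer v \<in> borel_measurable borel"
  unfolding transfer_def by measurable

lemma branch_prob_nonneg: "0 \<le> y \<Longrightarrow> 0 \<le> branch_prob i y"
  by (simp add: branch_prob_def)

lemma branch_prob_eq_diff:
  "0 \<le> y \<Longrightarrow> branch_prob i y = (1 + y) / (y + real i + 1) - (1 + y) / (y + real (Suc i) + 1)"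
  by (simp add: branch_prob_def field_simps)

lemma branch_prob_sums:
  assumes "0 \<le> y"
  shows "(\<lambda>i. branch_prob i y) sums 1"
proof -
  have "(\<lambda>i. (1 + y) / (y + real i + 1)) \<longlonglongrightarrow> 0"
    by real_asymp
  from telescope_sums'[OF this] show ?thesis
    using assms by (simp add: branch_prob_eq_diff add.commute[of y 1])
qed

lemma summable_branch_prob_mult:
  assumes "0 \<le> y" "\<And>i. \<bar>b i\<bar> \<le> B"
  shows "summable (\<lambda>i. branch_prob i y * b i)"
proof (rule summable_comparison_test[OF exI, of 0])
  show "summable (\<lambda>i. branch_prob i y * B)"
    using branch_prob_sums[OF assms(1)] by (auto intro: summable_mult2 sums_summable)
  show "\<forall>n\<ge>0. norm (branch_prob n y * b n) \<le> branch_prob n y * B"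
    using assms branch_prob_nonneg by (auto simp: abs_mult intro!: mult_left_mono)
qed

lemma abs_branch_prob_suminf_le:
  assumes "0 \<le> y" "\<And>i. \<bar>b i\<bar> \<le> B"
  shows "\<bar>\<Sum>i. branch_prob i y * b i\<bar> \<le> B"
proof -
  have s: "summable (\<lambda>i. \<bar>branch_prob i y * b i\<bar>)"
    using summable_branch_prob_mult[of y "\<lambda>i. \<bar>b i\<bar>" B] assms branch_prob_nonneg
    by (simp add: abs_mult)
  have "\<bar>\<Sum>i. branch_prob i y * b i\<bar> \<le> (\<Sum>i. \<bar>branch_prob i y * b i\<bar>)"
    by (rule summable_rabs[OF s])
  also have "\<dots> \<le> (\<Sum>i. branch_prob i y * B)"
    using s sums_summable[OF branch_prob_sums[OF assms(1)]] assms branch_prob_nonneg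
    by (intro suminf_le) (auto simp: abs_mult intro!: mult_left_mono summable_mult2)
  also have "\<dots> = B"
    using sums_mult2[OF branch_prob_sums[OF assms(1)], of B] by (simp add: sums_iff)
  finally show ?thesis .
qed

lemma branch_arg:
  assumes "y \<in> {0..1}"
  shows "1 / (y + real (Suc i)) \<in> {0<..1}"
  using assms by auto

text \<open>On branch \<open>j\<close>, the Gauss density at the branch point times the Jacobian is
  \<open>branch_prob j y\<close> times the Gauss density at \<open>y\<close>. The bound
  \<open>B\<close> makes the real series in \<open>transfer H\<close> converge, so that it agrees
  with the sum in \<open>ennreal\<close>.\<close>

lemma nn_integral_transfer:
  fixes H :: "real \<Rightarrow> real"
  assumes [measurable]: "H \<in> borel_measurable borel"
    and nn: "\<And>x. x \<in> {0<..1} \<Longrightarrow> 0 \<le> H x" and bd: "\<And>x. x \<in> {0<..1} \<Longrightarrow> H x \<le> B"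
  shows "(\<integral>\<^sup>+x. H x \<partial>\<gamma>) = (\<integral>\<^sup>+x. transfer H x \<partial>\<gamma>)"
proof -
  have "(\<integral>\<^sup>+x. H x \<partial>\<gamma>) = (\<integral>\<^sup>+x. ennreal (1 / (ln 2 * (1 + x))) * ennreal (H x) * indicator {0<..<1} x \<partial>lborel)"
    by (rule nn_integral_gauss_measure) measurable
  also have "\<dots> = (\<integral>\<^sup>+y. (\<Sum>j. (ennreal (1 / (ln 2 * (1 + 1 / (y + real (Suc j))))) *
       ennreal (H (1 / (y + real (Suc j))))) * ennreal (1 / (y + real (Suc j))^2)) *
      indicator {0<..<1} y \<partial>lborel)"
    by (rule nn_integral_branches) measurable
  also have "\<dots> = (\<integral>\<^sup>+x. ennreal (1 / (ln 2 * (1 + x))) * ennreal (transfer H x) * indicator {0<..<1} x \<partial>lborel)"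
  proof (intro nn_integral_cong)
    fix y :: real
    show "(\<Sum>j. (ennreal (1 / (ln 2 * (1 + 1 / (y + real (Suc j))))) *
       ennreal (H (1 / (y + real (Suc j))))) * ennreal (1 / (y + real (Suc j))^2)) *
      indicator {0<..<1} y = ennreal (1 / (ln 2 * (1 + y))) * ennreal (transfer H y) * indicator {0<..<1} y"
    proof (cases "y \<in> {0<..<1}")
      case y: True
      have arg: "1 / (y + real (Suc j)) \<in> {0<..1}" for j using y by (intro branch_arg) auto
      have bd': "\<bar>H (1 / (y + real (Suc j)))\<bar> \<le> B" for j using nn[OF arg, of j] bd[OF arg, of j] by simp
      have "(\<Sum>j. (ennreal (1 / (ln 2 * (1 + 1 / (y + real (Suc j))))) *
         ennreal (H (1 / (y + real (Suc j))))) * ennreal (1 / (y + real (Suc j))^2)) =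
         (\<Sum>j. ennreal (1 / (ln 2 * (1 + y)) * (branch_prob j y * H (1 / (y + real (Suc j))))))"
      proof (intro arg_cong[where f = suminf] ext)
        fix j
        have eq: "1 / (ln 2 * (1 + 1 / (y + real (Suc j)))) * (1 / (y + real (Suc j))^2) =
           1 / (ln 2 * (1 + y)) * branch_prob j y"
          using y by (simp add: branch_prob_def divide_simps power2_eq_square)
             (simp add: algebra_simps)
        show "(ennreal (1 / (ln 2 * (1 + 1 / (y + real (Suc j))))) *
         ennreal (H (1 / (y + real (Suc j))))) * ennreal (1 / (y + real (Suc j))^2) =
         ennreal (1 / (ln 2 * (1 + y)) * (branch_prob j y * H (1 / (y + real (Suc j)))))"
          using y nn[OF arg, of j]
          by (simp only: ennreal_mult''[symmetric] zero_le_power2 zero_le_divide_1_iff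
              mult.assoc[symmetric] eq[symmetric]) (simp only: mult_ac)
      qed
      also have "\<dots> = ennreal (\<Sum>j. 1 / (ln 2 * (1 + y)) * (branch_prob j y * H (1 / (y + real (Suc j)))))"
        using y nn[OF arg] branch_prob_nonneg[of y] bd'
        by (intro suminf_ennreal2 summable_mult summable_branch_prob_mult[where B = B] mult_nonneg_nonneg)
          auto
      also have "\<dots> = ennreal (1 / (ln 2 * (1 + y)) * transfer H y)"
        unfolding transfer_def using y bd'
        by (subst suminf_mult) (auto intro!: summable_branch_prob_mult[where B = B])
      also have "\<dots> = ennreal (1 / (ln 2 * (1 + y))) * ennreal (transfer H y)"
        using y nn[OF arg] branch_prob_nonneg[of y] bd' unfolding transfer_def
        by (intro ennreal_mult suminf_nonneg summable_branch_prob_mult[where B = B]) auto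
      finally show ?thesis by simp
    qed simp
  qed
  also have "\<dots> = (\<integral>\<^sup>+x. transfer H x \<partial>\<gamma>)"
    by (rule nn_integral_gauss_measure[symmetric]) measurable
  finally show ?thesis .
qed

interpretation gauss: prob_space \<gamma>
  by (rule prob_space_gauss_measure)

lemma integrable_gauss_bounded:
  fixes H :: "real \<Rightarrow> real"
  assumes "H \<in> borel_measurable borel" "\<And>x. x \<in> {0<..1} \<Longrightarrow> \<bar>H x\<bar> \<le> B"
  shows "integrable \<gamma> H"
  using assms
  by (intro gauss.integrable_const_bound[where B = B] measurable_gauss_measure AE_I2)
    (auto simp: space_gauss_measure)

lemma transfer_bounded:
  assumes "\<And>x. x \<in> {0<..1} \<Longrightarrow> \<bar>H x\<bar> \<le> B" "y \<in> {0..1}"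
  shows "\<bar>transfer H y\<bar> \<le> B"
  unfolding transfer_def using assms branch_arg[OF assms(2)]
  by (intro abs_branch_prob_suminf_le) auto

text \<open>Adding \<open>B\<close> makes \<open>H\<close> nonnegative, and the operator fixes
  constants because the branch weights sum to 1.\<close>

lemma integral_transfer:
  assumes [measurable]: "H \<in> borel_measurable borel"
    and bd: "\<And>x. x \<in> {0<..1} \<Longrightarrow> \<bar>H x\<bar> \<le> B"
  shows "(\<integral>x. H x \<partial>\<gamma>) = (\<integral>x. transfer H x \<partial>\<gamma>)"
proof -
  let ?K = "\<lambda>x. H x + B"
  have K: "0 \<le> ?K x" "?K x \<le> 2 * B" if "x \<in> {0<..1}" for x using bd[OF that] by auto
  have tK: "transfer ?K y = transfer H y + B" if "y \<in> {0<..1}" for y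
  proof -
    have y: "0 \<le> y" "y \<in> {0..1}" using that by auto
    have b: "\<And>i. \<bar>H (1 / (y + real (Suc i)))\<bar> \<le> B" using bd branch_arg[OF y(2)] by auto
    have "(\<lambda>i. branch_prob i y * H (1 / (y + real (Suc i))) + branch_prob i y * B) sums (transfer H y + 1 * B)"
      unfolding transfer_def
      by (intro sums_add summable_sums summable_branch_prob_mult[OF y(1) b] sums_mult2 branch_prob_sums y(1))
    then show ?thesis
      unfolding transfer_def distrib_left[symmetric] by (simp only: sums_iff mult_1)
  qed
  have tb: "\<bar>transfer H y\<bar> \<le> B" if "y \<in> {0<..1}" for y
    using that by (intro transfer_bounded[OF bd]) auto
  have "(\<integral>x. ?K x \<partial>\<gamma>) = enn2real (\<integral>\<^sup>+x. ?K x \<partial>\<gamma>)"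
    by (intro integral_eq_nn_integral measurable_gauss_measure AE_I2 K(1))
      (simp_all add: space_gauss_measure)
  also have "\<dots> = enn2real (\<integral>\<^sup>+x. transfer ?K x \<partial>\<gamma>)"
    by (intro arg_cong[where f = enn2real] nn_integral_transfer[where B = "2 * B"] K) measurable
  also have "\<dots> = (\<integral>x. transfer ?K x \<partial>\<gamma>)"
  proof (intro integral_eq_nn_integral[symmetric] measurable_gauss_measure AE_I2)
    fix x assume "x \<in> space \<gamma>"
    then have "x \<in> {0<..1}" by (simp add: space_gauss_measure)
    from tK[OF this] tb[OF this] show "0 \<le> transfer ?K x" by linarith
  qed measurable
  also have "\<dots> = (\<integral>x. transfer H x + B \<partial>\<gamma>)"
    by (intro Bochner_Integration.integral_cong refl tK) (simp add: space_gauss_measure)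
  finally have "(\<integral>x. ?K x \<partial>\<gamma>) = (\<integral>x. transfer H x + B \<partial>\<gamma>)" .
  moreover have "integrable \<gamma> H" "integrable \<gamma> (transfer H)"
    by (rule integrable_gauss_bounded[OF _ bd] integrable_gauss_bounded[OF _ tb]; measurable)+
  ultimately show ?thesis
    by (simp add: gauss.prob_space)
qed

text \<open>Duality: on every branch over \<open>y\<close> the factor \<open>G (gauss_map x)\<close>
  is the constant \<open>G y\<close>, which leaves the series.\<close>

lemma integral_mult_gauss_map:
  fixes v G :: "real \<Rightarrow> real"
  assumes [measurable]: "v \<in> borel_measurable borel" "G \<in> borel_measurable borel"
    and bd: "\<And>x. x \<in> {0<..1} \<Longrightarrow> \<bar>v x\<bar> \<le> B" "\<And>x. \<bar>G x\<bar> \<le> C"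
  shows "(\<integral>x. v x * G (gauss_map x) \<partial>\<gamma>) = (\<integral>x. transfer v x * G x \<partial>\<gamma>)"
proof -
  have "0 \<le> B" "0 \<le> C" using bd(1)[of 1] bd(2)[of 0] by auto
  then have "(\<integral>x. v x * G (gauss_map x) \<partial>\<gamma>) = (\<integral>x. transfer (\<lambda>x. v x * G (gauss_map x)) x \<partial>\<gamma>)"
    using bd by (intro integral_transfer[where B = "B * C"]) (auto simp: abs_mult intro!: mult_mono)
  also have "\<dots> = (\<integral>x. transfer v x * G x \<partial>\<gamma>)"
  proof (intro integral_cong_AE measurable_gauss_measure eventually_mono[OF AE_gauss_irrational])
    fix x assume "x \<in> {0<..<1} - (\<rat>::real set)"
    then have x: "x \<in> {0<..<1}" "0 \<le> x" "x \<in> {0..1}" by auto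
    have b: "\<And>i. \<bar>v (1 / (x + real (Suc i)))\<bar> \<le> B" using bd branch_arg[OF x(3)] by auto
    have "transfer (\<lambda>x. v x * G (gauss_map x)) x = (\<Sum>i. branch_prob i x * v (1 / (x + real (Suc i))) * G x)"
      by (simp add: transfer_def gauss_branch(1)[OF x(1)] mult.assoc del: of_nat_Suc)
    also have "\<dots> = transfer v x * G x"
      unfolding transfer_def by (rule suminf_mult2[symmetric, OF summable_branch_prob_mult[OF x(2) b]])
    finally show "transfer (\<lambda>x. v x * G (gauss_map x)) x = transfer v x * G x" .
  qed measurable
  finally show ?thesis .
qed

lemma integral_gauss_map:
  fixes G :: "real \<Rightarrow> real"
  assumes [measurable]: "G \<in> borel_measurable borel" and bd: "\<And>x. \<bar>G x\<bar> \<le> C"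
  shows "(\<integral>x. G (gauss_map x) \<partial>\<gamma>) = (\<integral>x. G x \<partial>\<gamma>)"
proof -
  have "(\<integral>x. 1 * G (gauss_map x) \<partial>\<gamma>) = (\<integral>x. transfer (\<lambda>_. 1) x * G x \<partial>\<gamma>)"
    using bd by (intro integral_mult_gauss_map[where B = 1]) auto
  also have "\<dots> = (\<integral>x. G x \<partial>\<gamma>)"
    using branch_prob_sums
    by (intro Bochner_Integration.integral_cong) (auto simp: space_gauss_measure transfer_def sums_iff)
  finally show ?thesis by simp
qed

lemma integral_gauss_map_funpow:
  fixes G :: "real \<Rightarrow> real"
  assumes [measurable]: "G \<in> borel_measurable borel" and bd: "\<And>x. \<bar>G x\<bar> \<le> C"
  shows "(\<integral>x. G ((gauss_map ^^ n) x) \<partial>\<gamma>) = (\<integral>x. G x \<partial>\<gamma>)"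
proof (induction n)
  case (Suc n)
  have "(\<integral>x. G ((gauss_map ^^ Suc n) x) \<partial>\<gamma>) = (\<integral>x. G ((gauss_map ^^ n) (gauss_map x)) \<partial>\<gamma>)"
    by (simp add: funpow_swap1)
  also have "\<dots> = (\<integral>x. G ((gauss_map ^^ n) x) \<partial>\<gamma>)"
    using measurable_compose[OF measurable_gauss_map_funpow assms(1)] bd
    by (intro integral_gauss_map)
  finally show ?case using Suc by simp
qed simp

subsection \<open>Decorrelation of monotone functions\<close>

text \<open>With \<open>n = Suc i\<close> and \<open>x\<close>, \<open>y\<close> in the unit
  interval, the second factor of the numerator is positive for \<open>n = 1\<close>, of either sign
  for \<open>n = 2\<close> and negative from \<open>n = 3\<close> on. Its sign yields the
  monotonicity of the transfer operator, its size the Lipschitz bound for the weights.\<close>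

lemma branch_prob_diff:
  assumes "0 \<le> x" "0 \<le> y"
  shows "branch_prob i x - branch_prob i y =
    (y - x) * (x + y + x * y + 1 + real (Suc i) - real (Suc i)^2) /
    ((x + real i + 1) * (x + real i + 2) * ((y + real i + 1) * (y + real i + 2)))"
proof -
  have "branch_prob i x - branch_prob i y =
    ((1 + x) * ((y + real i + 1) * (y + real i + 2)) - (1 + y) * ((x + real i + 1) * (x + real i + 2))) /
    ((x + real i + 1) * (x + real i + 2) * ((y + real i + 1) * (y + real i + 2)))"
    unfolding branch_prob_def using assms by (subst diff_frac_eq) auto
  also have "(1 + x) * ((y + real i + 1) * (y + real i + 2)) - (1 + y) * ((x + real i + 1) * (x + real i + 2)) =
    (y - x) * (x + y + x * y + 1 + real (Suc i) - real (Suc i)^2)"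
    by (simp add: algebra_simps power2_eq_square)
  finally show ?thesis .
qed

lemma mono_on_unit_bound:
  fixes v :: "real \<Rightarrow> real"
  assumes "mono_on {0..1} v" "x \<in> {0..1}"
  shows "v 0 \<le> v x" "v x \<le> v 1" "\<bar>v x\<bar> \<le> \<bar>v 0\<bar> + \<bar>v 1\<bar>"
proof -
  show "v 0 \<le> v x" "v x \<le> v 1"
    using mono_onD[OF assms(1), of 0 x] mono_onD[OF assms(1), of x 1] assms(2) by auto
  then show "\<bar>v x\<bar> \<le> \<bar>v 0\<bar> + \<bar>v 1\<bar>" by linarith
qed

lemma summable_transfer_mono:
  fixes v :: "real \<Rightarrow> real"
  assumes "mono_on {0..1} v" "x \<in> {0..1}" "y \<in> {0..1}"
  shows "summable (\<lambda>i. branch_prob i x * v (1 / (y + real (Suc i))))"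
proof (rule summable_branch_prob_mult)
  fix i
  have "1 / (y + real (Suc i)) \<in> {0..1}" using branch_arg[OF assms(3), of i] by auto
  from mono_on_unit_bound(3)[OF assms(1) this]
  show "\<bar>v (1 / (y + real (Suc i)))\<bar> \<le> \<bar>v 0\<bar> + \<bar>v 1\<bar>" .
qed (use assms in auto)

text \<open>A larger \<open>y\<close> shifts weight to larger digits, where an increasing
  \<open>v\<close> is smaller, and it also lowers each branch point. The proof changes the weights
  first and the points second. As both weight sequences sum to 1, the constant \<open>b 1\<close>
  may be subtracted, which removes the one index whose weight difference has no fixed sign.\<close>

lemma transfer_antimono:
  assumes v: "mono_on {0..1} v" and xy: "0 \<le> x" "x \<le> y" "y \<le> 1"
  shows "transfer v y \<le> transfer v x"
proof -
  define b where "b i = v (1 / (y + real (Suc i)))" for i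
  have x: "x \<in> {0..1}" and y: "y \<in> {0..1}" using xy by auto
  have bm: "b j \<le> b i" if "i \<le> j" for i j
    unfolding b_def using branch_arg[OF y, of i] branch_arg[OF y, of j] that y
    by (intro mono_onD[OF v] divide_left_mono) auto
  have sx: "summable (\<lambda>i. branch_prob i x * b i)" and sy: "summable (\<lambda>i. branch_prob i y * b i)"
    unfolding b_def by (intro summable_transfer_mono[OF v] x y)+
  have one: "(\<lambda>i. branch_prob i x) sums 1" "(\<lambda>i. branch_prob i y) sums 1"
    using xy by (auto intro!: branch_prob_sums)
  text \<open>The sign of \<open>branch_prob i x - branch_prob i y\<close> changes only at \<open>i = 1\<close>.\<close>
  have pos: "0 \<le> (branch_prob i x - branch_prob i y) * (b i - b 1)" for i
  proof -
    define D where "D = x + y + x * y + 1 + real (Suc i) - real (Suc i)^2"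
    have eq: "branch_prob i x - branch_prob i y = D * ((y - x) /
      ((x + real i + 1) * (x + real i + 2) * ((y + real i + 1) * (y + real i + 2))))"
      unfolding D_def using branch_prob_diff[of x y i] xy by (simp add: mult_ac)
    have q: "0 \<le> (y - x) / ((x + real i + 1) * (x + real i + 2) * ((y + real i + 1) * (y + real i + 2)))"
      using xy by auto
    consider "i = 0" | "i = 1" | "2 \<le> i" by linarith
    then have "0 \<le> D * (b i - b 1)"
    proof cases
      case 1
      then show ?thesis using xy bm[of 0 1] by (auto simp: D_def intro!: mult_nonneg_nonneg)
    next
      case 3
      have "x * y \<le> 1" using xy by (simp add: mult_le_one)
      moreover have "3 * real (Suc i) \<le> real (Suc i)^2"
        using 3 unfolding power2_eq_square by (intro mult_right_mono) auto
      ultimately have "D \<le> 0" unfolding D_def using xy 3 by simp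
      then show ?thesis using bm[of 1 i] 3 by (intro mult_nonpos_nonpos) auto
    qed simp
    then have "0 \<le> D * (b i - b 1) * ((y - x) /
      ((x + real i + 1) * (x + real i + 2) * ((y + real i + 1) * (y + real i + 2))))"
      using q by (rule mult_nonneg_nonneg)
    then show ?thesis unfolding eq by (simp add: mult_ac)
  qed
  have "transfer v y = (\<Sum>i. branch_prob i y * b i)" by (simp add: transfer_def b_def)
  also have "\<dots> \<le> (\<Sum>i. branch_prob i x * b i)"
  proof -
    have "(\<lambda>i. (branch_prob i x * b i - branch_prob i y * b i) -
        (branch_prob i x * b 1 - branch_prob i y * b 1)) sums
      (((\<Sum>i. branch_prob i x * b i) - (\<Sum>i. branch_prob i y * b i)) - (1 * b 1 - 1 * b 1))"
      by (intro sums_diff sums_mult2 one summable_sums sx sy)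
    moreover have "(branch_prob i x * b i - branch_prob i y * b i) -
        (branch_prob i x * b 1 - branch_prob i y * b 1) = (branch_prob i x - branch_prob i y) * (b i - b 1)" for i
      by (simp add: algebra_simps)
    ultimately have "(\<lambda>i. (branch_prob i x - branch_prob i y) * (b i - b 1)) sums
      ((\<Sum>i. branch_prob i x * b i) - (\<Sum>i. branch_prob i y * b i))" by simp
    from sums_le[OF pos sums_zero this] show ?thesis by simp
  qed
  also have "\<dots> \<le> (\<Sum>i. branch_prob i x * v (1 / (x + real (Suc i))))"
  proof (intro suminf_le sx summable_transfer_mono[OF v] x)
    fix i
    have "b i \<le> v (1 / (x + real (Suc i)))"
      unfolding b_def using branch_arg[OF y, of i] branch_arg[OF x, of i] xy
      by (intro mono_onD[OF v] divide_left_mono) auto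
    then show "branch_prob i x * b i \<le> branch_prob i x * v (1 / (x + real (Suc i)))"
      using xy by (intro mult_left_mono branch_prob_nonneg) auto
  qed
  finally show ?thesis by (simp add: transfer_def)
qed

text \<open>The branch points over 1 are those over 0 without the first, and their weights are
  doubled. With S the sum over the common points, the values at 0 and 1 are
  \<open>v 1 / 2 + S\<close> and \<open>2 * S\<close>. The difference is \<open>v 1 / 2 - S\<close>,
  and S is at least \<open>v 0 / 2\<close> because the common weights add up to 1/2.\<close>

lemma transfer_osc:
  assumes v: "mono_on {0..1} v"
  shows "transfer v 0 - transfer v 1 \<le> (v 1 - v 0) / 2"
proof -
  define w where "w i = branch_prob (Suc i) 0" for i
  have w: "branch_prob i 1 = 2 * w i" for i
    by (simp add: w_def branch_prob_def algebra_simps)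
  have b0: "branch_prob 0 0 = 1 / 2" by (simp add: branch_prob_def)
  have s0: "summable (\<lambda>i. branch_prob i 0 * v (1 / (0 + real (Suc i))))"
    by (intro summable_transfer_mono[OF v]) auto
  have s1: "summable (\<lambda>i. w i * v (1 / real (Suc (Suc i))))"
    using s0 by (subst (asm) summable_Suc_iff[symmetric]) (simp add: w_def)
  have "(\<lambda>i. w i) sums (1 - 1 / 2)"
    using branch_prob_sums[of 0] unfolding w_def by (subst sums_Suc_iff) (simp add: b0)
  then have ws: "(\<lambda>i. w i * v 0) sums (v 0 / 2)"
    using sums_mult2[of w "1/2" "v 0"] by simp
  have "transfer v 0 = (\<Sum>i. w i * v (1 / real (Suc (Suc i)))) + v 1 / 2"
    unfolding transfer_def using suminf_split_head[OF s0] b0 by (simp add: w_def)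
  moreover have "transfer v 1 = 2 * (\<Sum>i. w i * v (1 / real (Suc (Suc i))))"
    unfolding transfer_def w using suminf_mult[OF s1, of 2] by (simp add: mult_ac add_ac)
  moreover have "v 0 / 2 \<le> (\<Sum>i. w i * v (1 / real (Suc (Suc i))))"
  proof -
    have "w i * v 0 \<le> w i * v (1 / real (Suc (Suc i)))" for i
    proof -
      have "0 \<le> w i" unfolding w_def by (intro branch_prob_nonneg) simp
      moreover have "1 / real (Suc (Suc i)) \<in> {0..1}" by auto
      ultimately show ?thesis using mono_on_unit_bound(1)[OF v] by (intro mult_left_mono) auto
    qed
    from sums_le[OF this ws summable_sums[OF s1]] show ?thesis .
  qed
  ultimately show ?thesis by (simp add: field_simps)
qed

text \<open>Duality removes one iterate of the Gauss map from the argument of \<open>G\<close>. As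
  \<open>transfer v\<close> is decreasing, the induction continues with its negative, which is
  increasing with at most half the oscillation; the covariance merely changes sign. At
  \<open>m = 0\<close>, the distance of \<open>v\<close> from its mean is at most the oscillation of
  \<open>v\<close>.\<close>

lemma mono_decorrelation:
  fixes v G :: "real \<Rightarrow> real"
  assumes [measurable]: "v \<in> borel_measurable borel" "G \<in> borel_measurable borel"
    and v: "mono_on {0..1} v" and G: "\<And>x. \<bar>G x\<bar> \<le> C"
  shows "\<bar>(\<integral>x. v x * G ((gauss_map ^^ m) x) \<partial>\<gamma>) - (\<integral>x. v x \<partial>\<gamma>) * (\<integral>x. G x \<partial>\<gamma>)\<bar> \<le>
    (v 1 - v 0) / 2 ^ m * (\<integral>x. \<bar>G x\<bar> \<partial>\<gamma>)"
  using assms(1) v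
proof (induction m arbitrary: v)
  case 0
  note [measurable] = 0(1)
  let ?e = "\<integral>x. v x \<partial>\<gamma>"
  let ?B = "\<bar>v 0\<bar> + \<bar>v 1\<bar>"
  have b: "\<bar>v x\<bar> \<le> ?B" if "x \<in> {0<..1}" for x
    using mono_on_unit_bound(3)[OF 0(2), of x] that by auto
  have iG: "integrable \<gamma> G" by (rule integrable_gauss_bounded[OF assms(2) G])
  have iv: "integrable \<gamma> v" by (rule integrable_gauss_bounded[OF 0(1) b])
  have ivG: "integrable \<gamma> (\<lambda>x. v x * G x)"
    using b G by (intro integrable_gauss_bounded[where B = "?B * C"]) (auto simp: abs_mult intro!: mult_mono)
  have ilo: "v 0 \<le> ?e" and ihi: "?e \<le> v 1"
    using mono_on_unit_bound(1,2)[OF 0(2)]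
    by (auto intro!: gauss.integral_ge_const gauss.integral_le_const iv AE_I2 simp: space_gauss_measure)
  have "(\<integral>x. v x * G x \<partial>\<gamma>) - ?e * (\<integral>x. G x \<partial>\<gamma>) = (\<integral>x. v x * G x - ?e * G x \<partial>\<gamma>)"
    using ivG iG by simp
  also have "\<bar>\<dots>\<bar> \<le> (\<integral>x. \<bar>v x * G x - ?e * G x\<bar> \<partial>\<gamma>)"
    by (rule integral_abs_bound)
  also have "\<dots> \<le> (\<integral>x. (v 1 - v 0) * \<bar>G x\<bar> \<partial>\<gamma>)"
  proof (intro integral_mono)
    fix x assume "x \<in> space \<gamma>"
    then have x: "x \<in> {0..1}" by (simp add: space_gauss_measure)
    have "v x * G x - ?e * G x = (v x - ?e) * G x" by (simp add: algebra_simps)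
    moreover have "\<bar>v x - ?e\<bar> \<le> v 1 - v 0"
      using mono_on_unit_bound(1,2)[OF 0(2) x] ilo ihi by linarith
    ultimately show "\<bar>v x * G x - ?e * G x\<bar> \<le> (v 1 - v 0) * \<bar>G x\<bar>"
      by (simp add: abs_mult mult_right_mono)
  qed (use ivG iG in auto)
  finally show ?case by simp
next
  case (Suc m)
  note [measurable] = Suc.prems(1)
  let ?w = "\<lambda>x. - transfer v x"
  have b: "\<bar>v x\<bar> \<le> \<bar>v 0\<bar> + \<bar>v 1\<bar>" if "x \<in> {0<..1}" for x
    using mono_on_unit_bound(3)[OF Suc.prems(2), of x] that by auto
  have mw: "mono_on {0..1} ?w"
    using transfer_antimono[OF Suc.prems(2)] by (auto intro!: mono_onI)
  have "(\<integral>x. v x * G ((gauss_map ^^ Suc m) x) \<partial>\<gamma>) = (\<integral>x. v x * G ((gauss_map ^^ m) (gauss_map x)) \<partial>\<gamma>)"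
    by (simp add: funpow_swap1)
  also have "\<dots> = (\<integral>x. transfer v x * G ((gauss_map ^^ m) x) \<partial>\<gamma>)"
    using b G by (intro integral_mult_gauss_map) measurable
  finally have 1: "(\<integral>x. v x * G ((gauss_map ^^ Suc m) x) \<partial>\<gamma>) = - (\<integral>x. ?w x * G ((gauss_map ^^ m) x) \<partial>\<gamma>)"
    by simp
  have 2: "(\<integral>x. v x \<partial>\<gamma>) = - (\<integral>x. ?w x \<partial>\<gamma>)"
    using integral_transfer[OF Suc.prems(1) b] by simp
  have "\<bar>(\<integral>x. ?w x * G ((gauss_map ^^ m) x) \<partial>\<gamma>) - (\<integral>x. ?w x \<partial>\<gamma>) * (\<integral>x. G x \<partial>\<gamma>)\<bar> \<le>
    (?w 1 - ?w 0) / 2 ^ m * (\<integral>x. \<bar>G x\<bar> \<partial>\<gamma>)"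
    by (intro Suc.IH mw) measurable
  also have "\<dots> \<le> (v 1 - v 0) / 2 ^ Suc m * (\<integral>x. \<bar>G x\<bar> \<partial>\<gamma>)"
  proof (intro mult_right_mono)
    have "(?w 1 - ?w 0) / 2 ^ m \<le> (v 1 - v 0) / 2 / 2 ^ m"
      using transfer_osc[OF Suc.prems(2)] by (intro divide_right_mono) auto
    then show "(?w 1 - ?w 0) / 2 ^ m \<le> (v 1 - v 0) / 2 ^ Suc m" by simp
  qed simp
  finally show ?case unfolding 1 2 by (simp add: abs_minus_commute)
qed

text \<open>The constant contains the weight \<open>branch_prob i 0\<close>. Summed against the
  absolute values of a digit function, it therefore gives a first moment instead of a
  supremum.\<close>

lemma branch_prob_lipschitz:
  assumes "x \<in> {0..1}" "y \<in> {0..1}"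
  shows "\<bar>branch_prob i x - branch_prob i y\<bar> \<le> 5 * branch_prob i 0 * \<bar>y - x\<bar>"
proof -
  define n where "n = real (Suc i)"
  have n: "1 \<le> n" by (simp add: n_def)
  have xy: "0 \<le> x" "x \<le> 1" "0 \<le> y" "y \<le> 1" using assms by auto
  have "x * y \<le> 1" using xy by (simp add: mult_le_one)
  moreover have "0 \<le> x * y" using xy by simp
  moreover have "n \<le> n^2" using n by (simp add: power2_eq_square)
  \<comment> \<open>For the upper bound, \<open>x + y + x * y + 1\<close> is at most 4, and
    \<open>n - n^2\<close> is not positive; for the lower bound, \<open>- n^2\<close> already
    suffices.\<close>
  ultimately have D: "\<bar>x + y + x * y + 1 + n - n^2\<bar> \<le> 5 * n^2"
    using xy n unfolding abs_le_iff by (intro conjI) linarith+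
  have "n * (n + 1) * (n * (n + 1)) \<le> (x + n) * (x + n + 1) * ((y + n) * (y + n + 1))"
    using xy n by (intro mult_mono) auto
  moreover have "0 < n * (n + 1) * (n * (n + 1))" using n by auto
  ultimately have "\<bar>(y - x) * (x + y + x * y + 1 + n - n^2) / ((x + n) * (x + n + 1) * ((y + n) * (y + n + 1)))\<bar>
    \<le> \<bar>y - x\<bar> * (5 * n^2) / (n * (n + 1) * (n * (n + 1)))"
    using xy n D unfolding abs_divide abs_mult
    by (intro frac_le mult_mono) auto
  also have "\<dots> = 5 * \<bar>y - x\<bar> / ((n + 1) * (n + 1))"
    using n by (simp add: power2_eq_square)
  also have "\<dots> \<le> 5 * \<bar>y - x\<bar> / (n * (n + 1))"
    using n by (intro divide_left_mono mult_right_mono) auto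
  also have "\<dots> = 5 * branch_prob i 0 * \<bar>y - x\<bar>"
    by (simp add: branch_prob_def n_def algebra_simps)
  finally show ?thesis
    using branch_prob_diff[OF xy(1,3), of i] by (simp add: n_def add_ac)
qed

lemma branch_prob_ge:
  assumes "y \<in> {0..1}"
  shows "branch_prob i 0 \<le> 4 * branch_prob i y"
proof -
  have "(1 + 0) / ((0 + real i + 1) * (0 + real i + 2)) \<le> 4 * 1 / ((1 + real i + 1) * (1 + real i + 2))"
    by (simp add: divide_simps) (simp add: algebra_simps)
  also have "\<dots> \<le> 4 * (1 + y) / ((y + real i + 1) * (y + real i + 2))"
    using assms by (intro frac_le mult_mono) auto
  finally show ?thesis by (simp add: branch_prob_def)
qed

subsection \<open>Variance of digit sums\<close>

lemma measurable_digit_fun [measurable]: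
  fixes g :: "nat \<Rightarrow> 'b::topological_space"
  shows "(\<lambda>x. g (gauss_digits x k)) \<in> borel_measurable borel"
  by (rule measurable_compose[OF measurable_gauss_digits]) simp

lemma gauss_digits_funpow: "gauss_digits ((gauss_map ^^ m) x) k = gauss_digits x (m + k)"
proof -
  have "(gauss_map ^^ k) ((gauss_map ^^ m) x) = (gauss_map ^^ (k + m)) x"
    by (simp add: funpow_add)
  then show ?thesis by (simp add: gauss_digits_def add.commute)
qed

lemma integral_gauss_digits_shift:
  fixes g :: "nat \<Rightarrow> real"
  assumes "\<And>i. \<bar>g i\<bar> \<le> C"
  shows "(\<integral>x. g (gauss_digits x k) \<partial>\<gamma>) = (\<integral>x. g (gauss_digits x 0) \<partial>\<gamma>)"
  using integral_gauss_map_funpow[of "\<lambda>x. g (gauss_digits x 0)" C k] assms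
  by (simp add: gauss_digits_funpow)

text \<open>The weights at 0 are at most 4 times those at any other point, so the sum is at most 4
  times the transferred function everywhere off a null set, and hence on average. It serves to bound
  a Lipschitz constant by a first moment.\<close>

lemma suminf_branch_prob_le_expectation:
  fixes g :: "nat \<Rightarrow> real"
  assumes "\<And>i. \<bar>g i\<bar> \<le> C"
  shows "(\<Sum>i. branch_prob i 0 * \<bar>g (Suc i)\<bar>) \<le> 4 * (\<integral>x. \<bar>g (gauss_digits x 0)\<bar> \<partial>\<gamma>)"
proof -
  let ?S = "\<Sum>i. branch_prob i 0 * \<bar>g (Suc i)\<bar>"
  let ?u = "\<lambda>x. \<bar>g (gauss_digits x 0)\<bar>"
  have tb: "\<bar>transfer ?u x\<bar> \<le> C" if "x \<in> {0<..1}" for x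
    using assms that by (intro transfer_bounded) auto
  have "?S = (\<integral>x. ?S \<partial>\<gamma>)" by (simp add: gauss.prob_space)
  also have "\<dots> \<le> (\<integral>x. 4 * transfer ?u x \<partial>\<gamma>)"
  proof (intro integral_mono_AE eventually_mono[OF AE_gauss_irrational])
    show "integrable \<gamma> (\<lambda>x. 4 * transfer ?u x)"
      using tb by (intro integrable_mult_right integrable_gauss_bounded[where B = C]) auto
    fix x assume "x \<in> {0<..<1} - (\<rat>::real set)"
    then have x: "x \<in> {0<..<1}" "x \<in> {0..1}" "0 \<le> x" by auto
    have s: "summable (\<lambda>i. branch_prob i x * \<bar>g (Suc i)\<bar>)"
      using assms x by (intro summable_branch_prob_mult) auto
    have "?S \<le> (\<Sum>i. 4 * (branch_prob i x * \<bar>g (Suc i)\<bar>))"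
      using branch_prob_ge[OF x(2)] s assms x(3)
      by (intro suminf_le summable_mult summable_branch_prob_mult[where B = C])
        (auto intro: mult_right_mono simp: mult.assoc[symmetric])
    also have "\<dots> = 4 * transfer ?u x"
      unfolding transfer_def gauss_branch(2)[OF x(1)] by (rule suminf_mult[OF s])
    finally show "?S \<le> 4 * transfer ?u x" .
  qed simp
  also have "\<dots> = 4 * (\<integral>x. ?u x \<partial>\<gamma>)"
    using assms by (simp add: integral_transfer[of ?u C])
  finally show ?thesis .
qed

text \<open>
  Conditionally on the future, the expectation of \<open>g a\<^sub>1\<close> is a Lipschitz function, hence a
  difference of two increasing ones, to which the decorrelation estimate applies.
\<close>

lemma digit_covariance_bound:
  fixes g :: "nat \<Rightarrow> real"
  assumes g: "\<And>i. \<bar>g i\<bar> \<le> C"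
  shows "\<bar>(\<integral>x. g (gauss_digits x 0) * g (gauss_digits x (Suc m)) \<partial>\<gamma>) - (\<integral>x. g (gauss_digits x 0) \<partial>\<gamma>)^2\<bar>
    \<le> 60 / 2 ^ m * (\<integral>x. \<bar>g (gauss_digits x 0)\<bar> \<partial>\<gamma>)^2"
proof -
  let ?u = "\<lambda>x. g (gauss_digits x 0)"
  let ?um = "\<lambda>x. g (gauss_digits x m)"
  define E where "E = (\<integral>x. \<bar>?u x\<bar> \<partial>\<gamma>)"
  define L where "L = 5 * (\<Sum>i. branch_prob i 0 * \<bar>g (Suc i)\<bar>)"
  \<comment> \<open>Almost everywhere this is \<open>transfer ?u\<close>, but the digit is entered
    directly as \<open>Suc i\<close>. In this form the function is Lipschitz on the closed interval,
    including the endpoint 1, where the branch points have other digits.\<close>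
  define \<phi> where "\<phi> y = (\<Sum>i. branch_prob i y * g (Suc i))" for y
  have [measurable]: "\<phi> \<in> borel_measurable borel" unfolding \<phi>_def by measurable
  have C: "0 \<le> C" using g[of 0] by linarith
  have L20: "L \<le> 20 * E"
    using suminf_branch_prob_le_expectation[of g, OF g] unfolding L_def E_def by simp
  have s0: "summable (\<lambda>i. branch_prob i 0 * \<bar>g (Suc i)\<bar>)"
    using g by (intro summable_branch_prob_mult[where B = C]) auto
  have L0: "0 \<le> L"
    unfolding L_def using s0 by (intro mult_nonneg_nonneg suminf_nonneg) (auto intro!: branch_prob_nonneg)
  have \<phi>b: "\<bar>\<phi> y\<bar> \<le> C" if "y \<in> {0<..1}" for y
    unfolding \<phi>_def using that g by (intro abs_branch_prob_suminf_le) auto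
  have lip: "\<bar>\<phi> x - \<phi> y\<bar> \<le> L * \<bar>y - x\<bar>" if x: "x \<in> {0..1}" and y: "y \<in> {0..1}" for x y
  proof -
    have s: "summable (\<lambda>i. branch_prob i z * g (Suc i))" if "z \<in> {0..1}" for z
      using that g by (intro summable_branch_prob_mult[where B = C]) auto
    have "\<phi> x - \<phi> y = (\<Sum>i. (branch_prob i x - branch_prob i y) * g (Suc i))"
      unfolding \<phi>_def suminf_diff[OF s[OF x] s[OF y]] by (simp add: algebra_simps)
    also have "\<bar>\<dots>\<bar> \<le> (\<Sum>i. 5 * \<bar>y - x\<bar> * (branch_prob i 0 * \<bar>g (Suc i)\<bar>))"
    proof (rule order_trans[OF summable_rabs suminf_le])
      fix i
      show le: "\<bar>(branch_prob i x - branch_prob i y) * g (Suc i)\<bar> \<le> 5 * \<bar>y - x\<bar> * (branch_prob i 0 * \<bar>g (Suc i)\<bar>)" for i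
        using mult_right_mono[OF branch_prob_lipschitz[OF x y, of i], of "\<bar>g (Suc i)\<bar>"]
        by (simp add: abs_mult mult_ac)
      show sm: "summable (\<lambda>i. 5 * \<bar>y - x\<bar> * (branch_prob i 0 * \<bar>g (Suc i)\<bar>))"
        by (intro summable_mult s0)
      show "summable (\<lambda>i. \<bar>(branch_prob i x - branch_prob i y) * g (Suc i)\<bar>)"
        by (rule summable_comparison_test[OF _ sm]) (use le in auto)
      then show "summable (\<lambda>i. \<bar>(branch_prob i x - branch_prob i y) * g (Suc i)\<bar>)" .
    qed
    also have "\<dots> = L * \<bar>y - x\<bar>"
      using suminf_mult[OF s0, of "5 * \<bar>y - x\<bar>"] by (simp add: L_def)
    finally show ?thesis .
  qed
  let ?\<phi>1 = "\<lambda>x. \<phi> x + L * x" and ?\<phi>2 = "\<lambda>x::real. L * x"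
  have m1: "mono_on {0..1} ?\<phi>1"
  proof (rule mono_onI)
    fix x y :: real assume xy: "x \<in> {0..1}" "y \<in> {0..1}" "x \<le> y"
    from lip[OF xy(1,2)] xy(3) have "\<phi> x - \<phi> y \<le> L * (y - x)" by simp
    then show "?\<phi>1 x \<le> ?\<phi>1 y" by (simp add: algebra_simps)
  qed
  have m2: "mono_on {0..1} ?\<phi>2"
    using L0 by (intro mono_onI mult_left_mono)
  have tr: "AE x in \<gamma>. transfer ?u x = \<phi> x"
    by (rule eventually_mono[OF AE_gauss_irrational]) (simp add: transfer_def \<phi>_def gauss_branch(2) del: of_nat_Suc)
  have "(\<integral>x. ?u x * g (gauss_digits x (Suc m)) \<partial>\<gamma>) = (\<integral>x. ?u x * (\<lambda>x. g (gauss_digits x m)) (gauss_map x) \<partial>\<gamma>)"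
    by (simp add: gauss_digits_Suc)
  also have "\<dots> = (\<integral>x. transfer ?u x * ?um x \<partial>\<gamma>)"
    using g by (intro integral_mult_gauss_map) auto
  also have "\<dots> = (\<integral>x. \<phi> x * ?um x \<partial>\<gamma>)"
    by (intro integral_cong_AE measurable_gauss_measure eventually_mono[OF tr]) auto
  finally have 1: "(\<integral>x. ?u x * g (gauss_digits x (Suc m)) \<partial>\<gamma>) = (\<integral>x. \<phi> x * ?um x \<partial>\<gamma>)" .
  have "(\<integral>x. ?u x \<partial>\<gamma>) = (\<integral>x. transfer ?u x \<partial>\<gamma>)"
    using g by (intro integral_transfer[where B = C]) auto
  also have "\<dots> = (\<integral>x. \<phi> x \<partial>\<gamma>)"
    by (intro integral_cong_AE measurable_gauss_measure tr) auto
  finally have 2: "(\<integral>x. ?u x \<partial>\<gamma>) = (\<integral>x. \<phi> x \<partial>\<gamma>)" .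
  have i\<phi>: "integrable \<gamma> \<phi>" by (rule integrable_gauss_bounded[OF _ \<phi>b]) auto
  have i2: "integrable \<gamma> ?\<phi>2"
  proof (rule integrable_gauss_bounded)
    fix x :: real assume "x \<in> {0<..1}"
    then have "L * \<bar>x\<bar> \<le> L * 1" using L0 by (intro mult_left_mono) auto
    then show "\<bar>L * x\<bar> \<le> L * 1" using L0 by (simp add: abs_mult)
  qed measurable
  have i\<phi>m: "integrable \<gamma> (\<lambda>x. \<phi> x * ?um x)"
    using g \<phi>b C by (intro integrable_gauss_bounded[where B = "C * C"]) (auto simp: abs_mult intro!: mult_mono)
  have i2m: "integrable \<gamma> (\<lambda>x. ?\<phi>2 x * ?um x)"
  proof (rule integrable_gauss_bounded)
    fix x :: real assume "x \<in> {0<..1}"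
    then have "L * \<bar>x\<bar> * \<bar>?um x\<bar> \<le> L * 1 * C" using L0 g by (intro mult_mono) auto
    then show "\<bar>L * x * ?um x\<bar> \<le> L * 1 * C" using L0 by (simp add: abs_mult)
  qed measurable
  have e1: "(\<integral>x. ?\<phi>1 x \<partial>\<gamma>) = (\<integral>x. \<phi> x \<partial>\<gamma>) + (\<integral>x. ?\<phi>2 x \<partial>\<gamma>)"
    using i\<phi> i2 by (rule Bochner_Integration.integral_add)
  have e2: "(\<integral>x. ?\<phi>1 x * ?um x \<partial>\<gamma>) = (\<integral>x. \<phi> x * ?um x \<partial>\<gamma>) + (\<integral>x. ?\<phi>2 x * ?um x \<partial>\<gamma>)"
    unfolding distrib_right using i\<phi>m i2m by (rule Bochner_Integration.integral_add)
  have d1: "\<bar>(\<integral>x. ?\<phi>1 x * ?um x \<partial>\<gamma>) - (\<integral>x. ?\<phi>1 x \<partial>\<gamma>) * (\<integral>x. ?u x \<partial>\<gamma>)\<bar> \<le> (?\<phi>1 1 - ?\<phi>1 0) / 2 ^ m * E"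
    and d2: "\<bar>(\<integral>x. ?\<phi>2 x * ?um x \<partial>\<gamma>) - (\<integral>x. ?\<phi>2 x \<partial>\<gamma>) * (\<integral>x. ?u x \<partial>\<gamma>)\<bar> \<le> (?\<phi>2 1 - ?\<phi>2 0) / 2 ^ m * E"
    using mono_decorrelation[of ?\<phi>1 ?u C m] mono_decorrelation[of ?\<phi>2 ?u C m] m1 m2 g
    unfolding E_def by (auto simp: gauss_digits_funpow)
  have E0: "0 \<le> E" unfolding E_def by simp
  \<comment> \<open>The two increasing functions have oscillations
    \<open>\<phi> 1 - \<phi> 0 + L\<close> and \<open>L\<close>, together at most
    \<open>3 * L\<close>. With \<open>L\<close> at most \<open>20 * E\<close> this gives the
    60.\<close>
  have "\<phi> 1 - \<phi> 0 \<le> L" using lip[of 0 1] by auto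
  then have o: "(?\<phi>1 1 - ?\<phi>1 0) + (?\<phi>2 1 - ?\<phi>2 0) \<le> 60 * E" using L20 L0 by auto
  have "\<bar>(\<integral>x. \<phi> x * ?um x \<partial>\<gamma>) - (\<integral>x. \<phi> x \<partial>\<gamma>) * (\<integral>x. ?u x \<partial>\<gamma>)\<bar>
      \<le> (?\<phi>1 1 - ?\<phi>1 0) / 2 ^ m * E + (?\<phi>2 1 - ?\<phi>2 0) / 2 ^ m * E"
    using d1 d2 unfolding e1 e2 distrib_right[of "\<integral>x. \<phi> x \<partial>\<gamma>"] by linarith
  also have "\<dots> = ((?\<phi>1 1 - ?\<phi>1 0) + (?\<phi>2 1 - ?\<phi>2 0)) * (E / 2 ^ m)"
    by (simp add: field_simps)
  also have "\<dots> \<le> (60 * E) * (E / 2 ^ m)"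
    using o E0 by (intro mult_right_mono) auto
  finally show ?thesis
    unfolding 1 power2_eq_square 2[symmetric] E_def[symmetric] by (simp add: mult_ac)
qed

lemma sum_half_powers_le: "(\<Sum>k<n. (1 / 2 :: real) ^ nat \<bar>int j - int k\<bar>) \<le> 4"
proof -
  have geo: "(\<Sum>i\<in>A. (1 / 2 :: real) ^ i) \<le> 2" if "finite A" for A :: "nat set"
  proof -
    have "(\<Sum>i\<in>A. (1 / 2 :: real) ^ i) \<le> (\<Sum>i. (1 / 2) ^ i)"
      by (intro sum_le_suminf that summable_geometric) auto
    then show ?thesis by (simp add: suminf_geometric)
  qed
  have "(\<Sum>k<n. (1 / 2 :: real) ^ nat \<bar>int j - int k\<bar>) =
      (\<Sum>k\<in>{k. k < n \<and> k \<le> j}. (1 / 2 :: real) ^ nat \<bar>int j - int k\<bar>) +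
      (\<Sum>k\<in>{k. k < n \<and> j < k}. (1 / 2 :: real) ^ nat \<bar>int j - int k\<bar>)"
    by (subst sum.union_disjoint[symmetric]) (auto intro!: sum.cong)
  also have "(\<Sum>k\<in>{k. k < n \<and> k \<le> j}. (1 / 2 :: real) ^ nat \<bar>int j - int k\<bar>) =
      (\<Sum>i\<in>(\<lambda>k. j - k) ` {k. k < n \<and> k \<le> j}. (1 / 2) ^ i)"
    by (subst sum.reindex) (auto intro!: inj_onI sum.cong arg_cong[where f = "power _"])
  also have "(\<Sum>k\<in>{k. k < n \<and> j < k}. (1 / 2 :: real) ^ nat \<bar>int j - int k\<bar>) =
      (\<Sum>i\<in>(\<lambda>k. k - j) ` {k. k < n \<and> j < k}. (1 / 2) ^ i)"
    by (subst sum.reindex) (auto intro!: inj_onI sum.cong arg_cong[where f = "power _"])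
  finally show ?thesis
    using geo[of "(\<lambda>k. j - k) ` {k. k < n \<and> k \<le> j}"] geo[of "(\<lambda>k. k - j) ` {k. k < n \<and> j < k}"] by simp
qed

lemma integrable_digit_fun:
  fixes g :: "nat \<Rightarrow> real"
  assumes "\<And>i. \<bar>g i\<bar> \<le> C"
  shows "integrable \<gamma> (\<lambda>x. g (gauss_digits x k))"
  using assms by (intro integrable_gauss_bounded) auto

text \<open>The covariance bound contains the square of the first absolute moment, which is at most
  the second moment, so \<open>C\<close> does not enter the estimate. The factor 480 is 120, from
  the single covariances, times 4, from two geometric series.\<close>

lemma digit_sum_variance_bound:
  fixes g :: "nat \<Rightarrow> real"
  assumes g: "\<And>i. \<bar>g i\<bar> \<le> C"
  defines "b \<equiv> \<integral>x. g (gauss_digits x 0) \<partial>\<gamma>"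
  shows "(\<integral>x. (\<Sum>k<n. g (gauss_digits x k) - b)^2 \<partial>\<gamma>) \<le> 480 * real n * (\<integral>x. (g (gauss_digits x 0))^2 \<partial>\<gamma>)"
proof -
  define V where "V = (\<integral>x. (g (gauss_digits x 0))^2 \<partial>\<gamma>)"
  let ?Y = "\<lambda>k x. g (gauss_digits x k) - b"
  have C: "0 \<le> C" using g[of 0] by linarith
  have int_g: "integrable \<gamma> (\<lambda>x. g (gauss_digits x k))" for k
    by (rule integrable_digit_fun[OF g])
  have int_gg: "integrable \<gamma> (\<lambda>x. g (gauss_digits x j) * g (gauss_digits x k))" for j k
    using g C by (intro integrable_gauss_bounded[where B = "C * C"]) (auto simp: abs_mult intro!: mult_mono)
  have Eg: "(\<integral>x. g (gauss_digits x k) \<partial>\<gamma>) = b" for k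
    unfolding b_def by (rule integral_gauss_digits_shift[OF g])
  have V0: "0 \<le> V" unfolding V_def by simp
  have abs_le_V: "(\<integral>x. \<bar>g (gauss_digits x 0)\<bar> \<partial>\<gamma>)^2 \<le> V"
  proof -
    have "0 \<le> gauss.variance (\<lambda>x. \<bar>g (gauss_digits x 0)\<bar>)"
      by (intro gauss.variance_positive)
    also have "\<dots> = V - (\<integral>x. \<bar>g (gauss_digits x 0)\<bar> \<partial>\<gamma>)^2"
      unfolding V_def using int_g[of 0] int_gg[of 0 0]
      by (subst gauss.variance_eq) (auto simp: power2_eq_square)
    finally show ?thesis by simp
  qed
  have YY: "?Y j x * ?Y k x = g (gauss_digits x j) * g (gauss_digits x k)
      - b * g (gauss_digits x j) - b * g (gauss_digits x k) + b^2" for j k x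
    by (simp add: algebra_simps power2_eq_square)
  have int_YY: "integrable \<gamma> (\<lambda>x. ?Y j x * ?Y k x)" for j k
    unfolding YY using int_g int_gg by auto
  have EYY: "(\<integral>x. ?Y j x * ?Y k x \<partial>\<gamma>) = (\<integral>x. g (gauss_digits x j) * g (gauss_digits x k) \<partial>\<gamma>) - b^2" for j k
    unfolding YY using int_g int_gg by (simp add: Eg gauss.prob_space power2_eq_square)
  have cov_less: "\<bar>\<integral>x. ?Y j x * ?Y k x \<partial>\<gamma>\<bar> \<le> 120 * V * (1 / 2) ^ (k - j)" if "j < k" for j k
  proof -
    \<comment> \<open>One of the \<open>k - j\<close> shifts is spent on conditioning, which leaves
      \<open>m\<close> for the decay; rewriting the bound with exponent \<open>k - j\<close> doubles
      60 to 120.\<close>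
    define m where "m = k - j - 1"
    have k: "k = j + Suc m" using that by (simp add: m_def)
    have "(\<integral>x. g (gauss_digits x j) * g (gauss_digits x k) \<partial>\<gamma>) =
       (\<integral>x. g (gauss_digits x 0) * g (gauss_digits x (Suc m)) \<partial>\<gamma>)"
      using integral_gauss_map_funpow[of "\<lambda>x. g (gauss_digits x 0) * g (gauss_digits x (Suc m))" "C * C" j] g C
      by (simp add: gauss_digits_funpow k abs_mult mult_mono)
    then have "\<bar>\<integral>x. ?Y j x * ?Y k x \<partial>\<gamma>\<bar> \<le> 60 / 2 ^ m * (\<integral>x. \<bar>g (gauss_digits x 0)\<bar> \<partial>\<gamma>)^2"
      unfolding EYY using digit_covariance_bound[of g, OF g] by (simp add: b_def)
    also have "\<dots> \<le> 60 / 2 ^ m * V" by (intro mult_left_mono abs_le_V) auto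
    also have "\<dots> = 120 * V * (1 / 2) ^ (k - j)" by (simp add: k field_simps)
    finally show ?thesis .
  qed
  have cov: "(\<integral>x. ?Y j x * ?Y k x \<partial>\<gamma>) \<le> 120 * V * (1 / 2) ^ nat \<bar>int j - int k\<bar>" for j k
  proof -
    consider "j < k" | "k < j" | "j = k" by linarith
    then show ?thesis
    proof cases
      case 1
      then have "nat \<bar>int j - int k\<bar> = k - j" by simp
      then show ?thesis using abs_le_D1[OF cov_less[OF 1]] by (simp only:)
    next
      case 2
      then have "nat \<bar>int j - int k\<bar> = j - k" by simp
      then show ?thesis using abs_le_D1[OF cov_less[OF 2]] by (simp only: mult.commute)
    next
      case 3
      have "(\<integral>x. (g (gauss_digits x j))^2 \<partial>\<gamma>) = V"
        unfolding V_def using g C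
        by (intro integral_gauss_digits_shift[where C = "C^2"]) (simp add: abs_le_square_iff[symmetric])
      then show ?thesis using V0 unfolding EYY 3
        by (simp add: power2_eq_square[symmetric]) (smt (verit) zero_le_power2)
    qed
  qed
  have "(\<integral>x. (\<Sum>k<n. ?Y k x)^2 \<partial>\<gamma>) = (\<integral>x. (\<Sum>j<n. \<Sum>k<n. ?Y j x * ?Y k x) \<partial>\<gamma>)"
    by (simp add: power2_eq_square sum_product)
  also have "\<dots> = (\<Sum>j<n. \<Sum>k<n. \<integral>x. ?Y j x * ?Y k x \<partial>\<gamma>)"
    using int_YY by (simp add: Bochner_Integration.integral_sum)
  also have "\<dots> \<le> (\<Sum>j<n. \<Sum>k<n. 120 * V * (1 / 2) ^ nat \<bar>int j - int k\<bar>)"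
    by (intro sum_mono cov)
  also have "\<dots> = (\<Sum>j<n. 120 * V * (\<Sum>k<n. (1 / 2) ^ nat \<bar>int j - int k\<bar>))"
    by (simp add: sum_distrib_left)
  also have "\<dots> \<le> (\<Sum>j<n. 120 * V * 4)"
    using V0 by (intro sum_mono mult_left_mono sum_half_powers_le) auto
  finally show ?thesis by (simp add: V_def)
qed

subsection \<open>Digit replacement\<close>

text \<open>
  The class of densities below contains the Gauss density and is preserved by each inverse
  branch of the Gauss map; on it, the oscillation is at most a factor of \<open>4\<close>.
\<close>

definition tempered :: "(real \<Rightarrow> real) \<Rightarrow> bool" where
  "tempered w \<longleftrightarrow> w \<in> borel_measurable borel \<and> (\<forall>x\<in>{0..1}. 0 \<le> w x) \<and>
    antimono_on {0..1} w \<and> mono_on {0..1} (\<lambda>x. (1 + x)^2 * w x)"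

text \<open>If \<open>x\<close> has density \<open>w\<close>, this is the density of
  \<open>gauss_map x\<close> on the event that the first digit is \<open>Suc j\<close>; it is not
  normalised.\<close>

definition pull_back :: "nat \<Rightarrow> (real \<Rightarrow> real) \<Rightarrow> real \<Rightarrow> real" where
  "pull_back j w y = w (1 / (y + real (Suc j))) / (y + real (Suc j))^2"

lemma tempered_gauss_density: "tempered (\<lambda>x. 1 / (ln 2 * (1 + x)))"
proof -
  have "mono_on {0..1} (\<lambda>x::real. (1 + x)^2 * (1 / (ln 2 * (1 + x))))"
  proof (rule mono_onI)
    fix x y :: real assume "x \<in> {0..1}" "y \<in> {0..1}" "x \<le> y"
    then have "(1 + x) / ln 2 \<le> (1 + y) / ln 2" by (intro divide_right_mono) auto
    with \<open>x \<in> {0..1}\<close> \<open>y \<in> {0..1}\<close>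
    show "(1 + x)^2 * (1 / (ln 2 * (1 + x))) \<le> (1 + y)^2 * (1 / (ln 2 * (1 + y)))"
      by (simp add: power2_eq_square)
  qed
  then show ?thesis
    unfolding tempered_def by (auto intro!: monotone_onI divide_left_mono mult_left_mono)
qed

text \<open>An inverse branch reverses the order, so the two monotonicity conditions exchange their
  roles. The growth of \<open>(1 + x)^2 * w x\<close> makes the new density decrease, since
  \<open>(1 + 1 / z) / (z + 1) = 1 / z\<close>. The decrease of \<open>w\<close> makes the new
  weighted density grow, since \<open>(1 + x) / (x + real (Suc j))\<close> is increasing.\<close>

lemma tempered_pull_back:
  assumes w: "tempered w"
  shows "tempered (pull_back j w)"
  unfolding tempered_def
proof (intro conjI ballI)
  note [measurable] = w[unfolded tempered_def, THEN conjunct1]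
  have nn: "\<And>x. x \<in> {0..1} \<Longrightarrow> 0 \<le> w x"
    and dec: "\<And>x y. x \<in> {0..1} \<Longrightarrow> y \<in> {0..1} \<Longrightarrow> x \<le> y \<Longrightarrow> w y \<le> w x"
    and inc: "\<And>x y. x \<in> {0..1} \<Longrightarrow> y \<in> {0..1} \<Longrightarrow> x \<le> y \<Longrightarrow> (1 + x)^2 * w x \<le> (1 + y)^2 * w y"
    using w unfolding tempered_def monotone_on_def by auto
  have arg: "1 / (x + real (Suc j)) \<in> {0..1}" if "x \<in> {0..1}" for x
    using branch_arg[OF that, of j] by auto
  show "pull_back j w \<in> borel_measurable borel"
    unfolding pull_back_def by measurable
  show "0 \<le> pull_back j w x" if "x \<in> {0..1}" for x
    unfolding pull_back_def by (intro divide_nonneg_nonneg nn arg that) auto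
  show "antimono_on {0..1} (pull_back j w)"
  proof (rule monotone_onI)
    fix x y :: real assume xy: "x \<in> {0..1}" "y \<in> {0..1}" "x \<le> y"
    define a b where "a = x + real (Suc j)" and "b = y + real (Suc j)"
    have ab: "1 \<le> a" "a \<le> b" using xy by (auto simp: a_def b_def)
    have "1 / b \<le> 1 / a" using ab by (intro divide_left_mono) auto
    with inc[of "1 / b" "1 / a"] arg[OF xy(1)] arg[OF xy(2)]
    have "(1 + 1 / b)^2 * w (1 / b) \<le> (1 + 1 / a)^2 * w (1 / a)" by (simp add: a_def b_def)
    moreover have "(1 / (b + 1))^2 \<le> (1 / (a + 1))^2"
      using ab by (intro power_mono divide_left_mono) auto
    moreover have "0 \<le> w (1 / a)" "0 \<le> w (1 / b)"
      using nn[OF arg] xy by (auto simp: a_def b_def)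
    ultimately have "((1 + 1 / b)^2 * w (1 / b)) * (1 / (b + 1))^2 \<le> ((1 + 1 / a)^2 * w (1 / a)) * (1 / (a + 1))^2"
      by - (rule mult_mono, auto)
    moreover have "(1 + 1 / z)^2 * u * (1 / (z + 1))^2 = u / z^2" if "1 \<le> z" for z u :: real
    proof -
      have "(1 + 1 / z) * (1 / (z + 1)) = 1 / z" using that by (simp add: field_simps)
      then have "(1 + 1 / z)^2 * (1 / (z + 1))^2 = (1 / z)^2" by (metis power_mult_distrib)
      then show ?thesis by (simp add: power_divide mult_ac)
    qed
    ultimately show "pull_back j w y \<le> pull_back j w x"
      using ab unfolding pull_back_def a_def[symmetric] b_def[symmetric] by simp
  qed
  show "mono_on {0..1} (\<lambda>x. (1 + x)^2 * pull_back j w x)"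
  proof (rule mono_onI)
    fix x y :: real assume xy: "x \<in> {0..1}" "y \<in> {0..1}" "x \<le> y"
    have le: "(1 + x) / (x + real (Suc j)) \<le> (1 + y) / (y + real (Suc j))"
    proof -
      have "1 - real j / (x + real (Suc j)) \<le> 1 - real j / (y + real (Suc j))"
        using xy by (intro diff_left_mono divide_left_mono) auto
      then show ?thesis using xy by (simp add: field_simps)
    qed
    have "((1 + x) / (x + real (Suc j)))^2 * w (1 / (x + real (Suc j))) \<le>
        ((1 + y) / (y + real (Suc j)))^2 * w (1 / (y + real (Suc j)))"
      using xy by (intro mult_mono power_mono le dec nn arg divide_left_mono) auto
    then show "(1 + x)^2 * pull_back j w x \<le> (1 + y)^2 * pull_back j w y"
      by (simp add: pull_back_def power_divide)
  qed
qed

lemma tempered_bounds: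
  assumes "tempered w" "x \<in> {0..1}"
  shows "w x \<le> w 0" "w 0 \<le> 4 * w x" "0 \<le> w x"
proof -
  have dec: "\<And>x y. x \<in> {0..1} \<Longrightarrow> y \<in> {0..1} \<Longrightarrow> x \<le> y \<Longrightarrow> w y \<le> w x"
    and inc: "\<And>x y. x \<in> {0..1} \<Longrightarrow> y \<in> {0..1} \<Longrightarrow> x \<le> y \<Longrightarrow> (1 + x)^2 * w x \<le> (1 + y)^2 * w y"
    using assms(1) unfolding tempered_def monotone_on_def by auto
  show "0 \<le> w x" using assms by (auto simp: tempered_def)
  show "w x \<le> w 0" using dec[of 0 x] assms(2) by auto
  have "w 0 \<le> 4 * w 1" using inc[of 0 1] by simp
  also have "w 1 \<le> w x" using dec[of x 1] assms(2) by auto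
  finally show "w 0 \<le> 4 * w x" by simp
qed

text \<open>Bounded distortion: up to constants, the density left behind by the first digit
  \<open>Suc j\<close> is \<open>w 0 * branch_prob j 0\<close>, whatever the remaining digits are.
  With n for \<open>Suc j\<close>, \<open>1 / n^2\<close> is at most
  \<open>2 / (n * (n + 1))\<close>, whence the 2. The 8 is the oscillation factor 4 times the 2 from
  comparing \<open>n * (n + 1)\<close> with \<open>(n + 1)^2\<close>.\<close>

lemma pull_back_bounds:
  assumes "tempered w" "y \<in> {0..1}"
  shows "pull_back j w y \<le> 2 * w 0 * branch_prob j 0"
    and "w 0 * branch_prob j 0 \<le> 8 * pull_back j w y"
proof -
  let ?z = "1 / (y + real (Suc j))"
  have z: "?z \<in> {0..1}" using branch_arg[OF assms(2), of j] by auto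
  note b = tempered_bounds[OF assms(1) z]
  have w0: "0 \<le> w 0" using b by linarith
  have "1 / (y + real (Suc j))^2 \<le> 1 / real (Suc j)^2"
    using assms(2) by (intro divide_left_mono power_mono) auto
  also have "\<dots> = 2 / (real (Suc j) * (2 * real (Suc j)))"
    by (simp add: power2_eq_square divide_simps)
  also have "\<dots> \<le> 2 / (real (Suc j) * (real j + 2))"
    by (intro divide_left_mono mult_left_mono mult_pos_pos) auto
  also have "\<dots> = 2 * branch_prob j 0"
    by (simp add: branch_prob_def add_ac)
  finally have "w ?z * (1 / (y + real (Suc j))^2) \<le> w 0 * (2 * branch_prob j 0)"
    using b w0 by (intro mult_mono) auto
  then show "pull_back j w y \<le> 2 * w 0 * branch_prob j 0" by (simp add: pull_back_def)
  have "branch_prob j 0 = 2 / (2 * (real j + 1) * (real j + 2))"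
    by (simp add: branch_prob_def divide_simps)
  also have "\<dots> \<le> 2 / ((real j + 2) * (real j + 2))"
    by (intro divide_left_mono mult_right_mono mult_pos_pos) auto
  also have "\<dots> = 2 / (1 + real (Suc j))^2"
    by (simp add: power2_eq_square add_ac)
  also have "\<dots> \<le> 2 / (y + real (Suc j))^2"
    using assms(2) by (intro divide_left_mono power_mono mult_pos_pos zero_less_power) auto
  finally have "w 0 * branch_prob j 0 \<le> (4 * w ?z) * (2 / (y + real (Suc j))^2)"
    using b w0 by (intro mult_mono branch_prob_nonneg) auto
  then show "w 0 * branch_prob j 0 \<le> 8 * pull_back j w y" by (simp add: pull_back_def)
qed

text \<open>\<open>R j\<close> is the event \<open>P\<close> seen through branch \<open>j\<close>.
  This splits an integral according to the value of the first digit.\<close>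

lemma nn_integral_pull_back:
  fixes w :: "real \<Rightarrow> real"
  assumes [measurable]: "w \<in> borel_measurable borel" "\<And>j. Measurable.pred borel (R j)" "Measurable.pred borel P"
    and R: "\<And>j y. y \<in> {0<..<1} \<Longrightarrow> P (1 / (y + real (Suc j))) \<longleftrightarrow> R j y"
  shows "(\<integral>\<^sup>+x. ennreal (if P x then w x else 0) * indicator {0<..<1} x \<partial>lborel) =
    (\<integral>\<^sup>+y. (\<Sum>j. ennreal (if R j y then pull_back j w y else 0)) * indicator {0<..<1} y \<partial>lborel)"
proof -
  have "(\<integral>\<^sup>+x. ennreal (if P x then w x else 0) * indicator {0<..<1} x \<partial>lborel) =
    (\<integral>\<^sup>+y. (\<Sum>j. ennreal (if P (1 / (y + real (Suc j))) then w (1 / (y + real (Suc j))) else 0) *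
       ennreal (1 / (y + real (Suc j))^2)) * indicator {0<..<1} y \<partial>lborel)"
    by (rule nn_integral_branches) measurable
  also have "\<dots> = (\<integral>\<^sup>+y. (\<Sum>j. ennreal (if R j y then pull_back j w y else 0)) * indicator {0<..<1} y \<partial>lborel)"
  proof (intro nn_integral_cong)
    fix y :: real
    show "(\<Sum>j. ennreal (if P (1 / (y + real (Suc j))) then w (1 / (y + real (Suc j))) else 0) *
       ennreal (1 / (y + real (Suc j))^2)) * indicator {0<..<1} y =
       (\<Sum>j. ennreal (if R j y then pull_back j w y else 0)) * indicator {0<..<1} y"
    proof (cases "y \<in> {0<..<1}")
      case True
      have "ennreal (if P (1 / (y + real (Suc j))) then w (1 / (y + real (Suc j))) else 0) *
         ennreal (1 / (y + real (Suc j))^2) = ennreal (if R j y then pull_back j w y else 0)" for j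
        unfolding R[OF True] pull_back_def
        by (subst ennreal_mult''[symmetric]) auto
      then show ?thesis by simp
    qed simp
  qed
  finally show ?thesis .
qed

text \<open>
  Replacing a moderate digit at position \<open>k\<close> by one with a large value of \<open>g\<close> moves the sum
  away from \<open>A\<close>, and costs only a constant factor times the probability of such a digit.
\<close>

lemma digit_replacement:
  fixes g :: "nat \<Rightarrow> real"
  assumes "tempered w" and c: "0 < c" and M: "M \<le> c / 4"
  defines "Q \<equiv> \<Sum>i. branch_prob i 0 * (if \<bar>g (Suc i)\<bar> > c then 1 else 0)"
  shows "ennreal Q * (\<integral>\<^sup>+x. ennreal (if \<bar>(\<Sum>j<k + Suc r. g (gauss_digits x j)) - A\<bar> \<le> c / 4 \<and>
      \<bar>g (gauss_digits x k)\<bar> \<le> M then w x else 0) * indicator {0<..<1} x \<partial>lborel) \<le>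
    16 * (\<integral>\<^sup>+x. ennreal (if \<bar>(\<Sum>j<k + Suc r. g (gauss_digits x j)) - A\<bar> > c / 4 \<and>
      \<bar>g (gauss_digits x k)\<bar> > c then w x else 0) * indicator {0<..<1} x \<partial>lborel)"
  using assms(1)
proof (induction k arbitrary: w A)
  case 0
  note w = 0
  have [measurable]: "w \<in> borel_measurable borel" using w by (simp add: tempered_def)
  have [measurable]: "pull_back j w \<in> borel_measurable borel" for j
    using tempered_pull_back[OF w] by (simp add: tempered_def)
  define S where "S y = (\<Sum>j<r. g (gauss_digits y j))" for y
  have [measurable]: "S \<in> borel_measurable borel" unfolding S_def by measurable
  have step: "(\<Sum>j<0 + Suc r. g (gauss_digits (1 / (y + real (Suc i))) j)) = g (Suc i) + S y"
    "gauss_digits (1 / (y + real (Suc i))) 0 = Suc i"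
    if "y \<in> {0<..<1}" for i y
    unfolding add_0 sum.lessThan_Suc_shift gauss_digits_Suc S_def
    by (simp_all only: gauss_branch[OF that])
  let ?good = "\<lambda>i y. \<bar>g (Suc i) + S y - A\<bar> \<le> c / 4 \<and> \<bar>g (Suc i)\<bar> \<le> M"
  let ?bad = "\<lambda>i y. \<bar>g (Suc i) + S y - A\<bar> > c / 4 \<and> \<bar>g (Suc i)\<bar> > c"
  have sQ: "summable (\<lambda>i. branch_prob i 0 * (if \<bar>g (Suc i)\<bar> > c then 1 else 0))"
    by (intro summable_branch_prob_mult[where B = 1]) auto
  have Q0: "0 \<le> Q" unfolding Q_def by (intro suminf_nonneg sQ) (auto intro: branch_prob_nonneg)
  have w0: "0 \<le> w 0" using tempered_bounds[OF w, of 0] by auto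
  have pointwise: "ennreal Q * (\<Sum>i. ennreal (if ?good i y then pull_back i w y else 0)) \<le>
      16 * (\<Sum>i. ennreal (if ?bad i y then pull_back i w y else 0))" if "y \<in> {0<..<1}" for y
  proof (cases "\<exists>i. ?good i y")
    case False
    then have "ennreal (if ?good i y then pull_back i w y else 0) = 0" for i by (auto simp only: if_False ennreal_0 split: if_split)
    then show ?thesis by (simp only: suminf_zero mult_zero_right zero_le)
  next
    case True
    have y: "y \<in> {0..1}" using that by auto
    \<comment> \<open>One good digit for this \<open>y\<close> forces the distance of
      \<open>S y\<close> from \<open>A\<close> to be at most \<open>c / 4 + M\<close>, hence at most
      \<open>c / 2\<close>. A digit with value beyond \<open>c\<close> then puts the sum more than
      \<open>c / 2\<close> away from \<open>A\<close>.\<close>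
    have far: "?bad i y" if "\<bar>g (Suc i)\<bar> > c" for i
      using True that M c by (auto simp: abs_if split: if_splits)
    have "(\<Sum>i. ennreal (if ?good i y then pull_back i w y else 0)) \<le> (\<Sum>i. ennreal (2 * w 0 * branch_prob i 0))"
      using pull_back_bounds(1)[OF w y] w0 branch_prob_nonneg[of 0]
      by (intro suminf_le ennreal_leI) auto
    also have "\<dots> = ennreal (2 * w 0 * 1)"
      using w0 branch_prob_nonneg[of 0] by (intro suminf_ennreal_eq sums_mult branch_prob_sums) auto
    finally have 1: "ennreal Q * (\<Sum>i. ennreal (if ?good i y then pull_back i w y else 0)) \<le> ennreal (Q * (2 * w 0))"
      using Q0 w0 by (simp add: ennreal_mult mult_left_mono)
    \<comment> \<open>The good side is at most \<open>2 * w 0 * Q\<close>, the bad side at least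
      \<open>w 0 / 8 * Q\<close>; the ratio of the constants is 16.\<close>
    have "ennreal (w 0 / 8 * Q) =
        (\<Sum>i. ennreal (w 0 / 8 * (branch_prob i 0 * (if \<bar>g (Suc i)\<bar> > c then 1 else 0))))"
      unfolding Q_def using w0 branch_prob_nonneg[of 0]
      by (intro suminf_ennreal_eq[symmetric] sums_mult summable_sums sQ) auto
    also have "\<dots> \<le> (\<Sum>i. ennreal (if ?bad i y then pull_back i w y else 0))"
    proof (intro suminf_le ennreal_leI)
      fix i
      show "w 0 / 8 * (branch_prob i 0 * (if \<bar>g (Suc i)\<bar> > c then 1 else 0)) \<le>
        (if ?bad i y then pull_back i w y else 0)"
        using far[of i] pull_back_bounds(2)[OF w y, of i] by auto
    qed auto
    finally have "16 * ennreal (w 0 / 8 * Q) \<le> 16 * (\<Sum>i. ennreal (if ?bad i y then pull_back i w y else 0))"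
      by (intro mult_left_mono) auto
    also have "16 * ennreal (w 0 / 8 * Q) = ennreal (16 * (w 0 / 8 * Q))"
      using w0 Q0 by (intro numeral_mult_ennreal) auto
    finally show ?thesis using 1 by (simp add: mult_ac)
  qed
  have eqg: "(\<integral>\<^sup>+x. ennreal (if \<bar>(\<Sum>j<0 + Suc r. g (gauss_digits x j)) - A\<bar> \<le> c / 4 \<and>
      \<bar>g (gauss_digits x 0)\<bar> \<le> M then w x else 0) * indicator {0<..<1} x \<partial>lborel) =
      (\<integral>\<^sup>+y. (\<Sum>j. ennreal (if ?good j y then pull_back j w y else 0)) * indicator {0<..<1} y \<partial>lborel)"
    by (intro nn_integral_pull_back) (measurable, simp only: step)
  have eqb: "(\<integral>\<^sup>+x. ennreal (if \<bar>(\<Sum>j<0 + Suc r. g (gauss_digits x j)) - A\<bar> > c / 4 \<and>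
      \<bar>g (gauss_digits x 0)\<bar> > c then w x else 0) * indicator {0<..<1} x \<partial>lborel) =
      (\<integral>\<^sup>+y. (\<Sum>j. ennreal (if ?bad j y then pull_back j w y else 0)) * indicator {0<..<1} y \<partial>lborel)"
    by (intro nn_integral_pull_back) (measurable, simp only: step)
  show ?case
    unfolding eqg eqb
    by (subst (1 2) nn_integral_cmult[symmetric], measurable, intro nn_integral_mono)
      (use pointwise in \<open>auto simp: indicator_def\<close>)
next
  \<comment> \<open>The first digit is stripped off: its value goes into the center
    \<open>A\<close>, its branch into the density. Hence the induction is over all tempered
    \<open>w\<close> and all \<open>A\<close>.\<close>
  case (Suc k)
  note w = Suc.prems
  have [measurable]: "w \<in> borel_measurable borel" using w by (simp add: tempered_def)
  have [measurable]: "pull_back j w \<in> borel_measurable borel" for j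
    using tempered_pull_back[OF w] by (simp add: tempered_def)
  let ?S = "\<lambda>y. \<Sum>j<k + Suc r. g (gauss_digits y j)"
  have step: "(\<Sum>j<Suc k + Suc r. g (gauss_digits (1 / (y + real (Suc i))) j)) - A = ?S y - (A - g (Suc i))"
    "gauss_digits (1 / (y + real (Suc i))) (Suc k) = gauss_digits y k"
    if "y \<in> {0<..<1}" for i y
    unfolding add_Suc sum.lessThan_Suc_shift gauss_digits_Suc gauss_branch[OF that]
    by simp_all
  let ?good = "\<lambda>i y. \<bar>?S y - (A - g (Suc i))\<bar> \<le> c / 4 \<and> \<bar>g (gauss_digits y k)\<bar> \<le> M"
  let ?bad = "\<lambda>i y. \<bar>?S y - (A - g (Suc i))\<bar> > c / 4 \<and> \<bar>g (gauss_digits y k)\<bar> > c"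
  have sum: "(\<integral>\<^sup>+y. (\<Sum>j. ennreal (if B j y then pull_back j w y else 0)) * indicator {0<..<1} y \<partial>lborel) =
      (\<Sum>j. \<integral>\<^sup>+y. ennreal (if B j y then pull_back j w y else 0) * indicator {0<..<1} y \<partial>lborel)"
    if [measurable]: "\<And>j. Measurable.pred borel (B j)" for B :: "nat \<Rightarrow> real \<Rightarrow> bool"
    unfolding ennreal_suminf_multc[symmetric] by (rule nn_integral_suminf) measurable
  have eqg: "(\<integral>\<^sup>+x. ennreal (if \<bar>(\<Sum>j<Suc k + Suc r. g (gauss_digits x j)) - A\<bar> \<le> c / 4 \<and>
      \<bar>g (gauss_digits x (Suc k))\<bar> \<le> M then w x else 0) * indicator {0<..<1} x \<partial>lborel) =
      (\<Sum>j. \<integral>\<^sup>+y. ennreal (if ?good j y then pull_back j w y else 0) * indicator {0<..<1} y \<partial>lborel)"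
    by (subst sum[symmetric], measurable, intro nn_integral_pull_back) (measurable, simp only: step)
  have eqb: "(\<integral>\<^sup>+x. ennreal (if \<bar>(\<Sum>j<Suc k + Suc r. g (gauss_digits x j)) - A\<bar> > c / 4 \<and>
      \<bar>g (gauss_digits x (Suc k))\<bar> > c then w x else 0) * indicator {0<..<1} x \<partial>lborel) =
      (\<Sum>j. \<integral>\<^sup>+y. ennreal (if ?bad j y then pull_back j w y else 0) * indicator {0<..<1} y \<partial>lborel)"
    by (subst sum[symmetric], measurable, intro nn_integral_pull_back) (measurable, simp only: step)
  show ?case
    unfolding eqg eqb ennreal_suminf_cmult[symmetric]
    by (intro suminf_le Suc.IH tempered_pull_back w) auto
qed

section \<open>Probabilities of digit events\<close>

lemma sets_gauss_Collect: "Measurable.pred borel P \<Longrightarrow> {x \<in> space \<gamma>. P x} \<in> sets \<gamma>"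
  by (rule predE) (rule measurable_gauss_measure)

lemma emeasure_gauss_eq_nn_integral:
  assumes [measurable]: "Measurable.pred borel P"
  shows "emeasure \<gamma> {x \<in> space \<gamma>. P x} =
    (\<integral>\<^sup>+x. ennreal (if P x then 1 / (ln 2 * (1 + x)) else 0) * indicator {0<..<1} x \<partial>lborel)"
proof -
  have [measurable]: "Measurable.pred \<gamma> P" by (rule measurable_gauss_measure) measurable
  have "emeasure \<gamma> {x \<in> space \<gamma>. P x} = (\<integral>\<^sup>+x. indicator {x \<in> space \<gamma>. P x} x \<partial>\<gamma>)"
    by simp
  also have "\<dots> = (\<integral>\<^sup>+x. (if P x then 1 else 0) \<partial>\<gamma>)"
    by (intro nn_integral_cong) (auto simp: indicator_def)
  also have "\<dots> = (\<integral>\<^sup>+x. ennreal (1 / (ln 2 * (1 + x))) * (if P x then 1 else 0) * indicator {0<..<1} x \<partial>lborel)"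
    by (rule nn_integral_gauss_measure) measurable
  also have "\<dots> = (\<integral>\<^sup>+x. ennreal (if P x then 1 / (ln 2 * (1 + x)) else 0) * indicator {0<..<1} x \<partial>lborel)"
    by (intro nn_integral_cong) auto
  finally show ?thesis .
qed

lemma prob_eq_expectation:
  assumes [measurable]: "Measurable.pred borel P"
  shows "measure \<gamma> {x \<in> space \<gamma>. P x} = (\<integral>x. (if P x then 1 else 0) \<partial>\<gamma>)"
proof -
  have [measurable]: "Measurable.pred \<gamma> P" by (rule measurable_gauss_measure) measurable
  have "(\<integral>x. (if P x then 1 else 0 :: real) \<partial>\<gamma>) = (\<integral>x. indicator {x \<in> space \<gamma>. P x} x \<partial>\<gamma>)"
    by (intro Bochner_Integration.integral_cong) (auto simp: indicator_def)
  then show ?thesis by simp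
qed

lemma branch_prob_le:
  assumes "y \<in> {0..1}"
  shows "branch_prob i y \<le> 2 * branch_prob i 0"
proof -
  have "(1 + y) / ((y + real i + 1) * (y + real i + 2)) \<le> 2 / ((0 + real i + 1) * (0 + real i + 2))"
    using assms by (intro frac_le mult_mono) auto
  then show ?thesis by (simp add: branch_prob_def)
qed

lemma tail_prob_le:
  fixes g :: "nat \<Rightarrow> real"
  shows "measure \<gamma> {x \<in> space \<gamma>. \<bar>g (gauss_digits x 0)\<bar> > c} \<le>
    2 * (\<Sum>i. branch_prob i 0 * (if \<bar>g (Suc i)\<bar> > c then 1 else 0))"
proof -
  let ?e = "\<lambda>i. if \<bar>g i\<bar> > c then 1 else (0::real)"
  let ?u = "\<lambda>x. ?e (gauss_digits x 0)"
  let ?Q = "\<Sum>i. branch_prob i 0 * ?e (Suc i)"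
  have tb: "\<bar>transfer ?u x\<bar> \<le> 1" if "x \<in> {0<..1}" for x
    using that by (intro transfer_bounded) auto
  have "measure \<gamma> {x \<in> space \<gamma>. \<bar>g (gauss_digits x 0)\<bar> > c} = (\<integral>x. ?u x \<partial>\<gamma>)"
    by (intro prob_eq_expectation) measurable
  also have "\<dots> = (\<integral>x. transfer ?u x \<partial>\<gamma>)"
    by (intro integral_transfer[where B = 1]) auto
  also have "\<dots> \<le> (\<integral>x. 2 * ?Q \<partial>\<gamma>)"
  proof (intro integral_mono_AE eventually_mono[OF AE_gauss_irrational])
    show "integrable \<gamma> (transfer ?u)"
      by (rule integrable_gauss_bounded[OF _ tb]) auto
    fix x assume "x \<in> {0<..<1} - (\<rat>::real set)"
    then have x: "x \<in> {0<..<1}" "x \<in> {0..1}" "0 \<le> x" by auto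
    have s: "summable (\<lambda>i. branch_prob i z * ?e (Suc i))" if "0 \<le> z" for z
      using that by (intro summable_branch_prob_mult[where B = 1]) auto
    have "transfer ?u x = (\<Sum>i. branch_prob i x * ?e (Suc i))"
      unfolding transfer_def gauss_branch(2)[OF x(1)] ..
    also have "\<dots> \<le> (\<Sum>i. 2 * (branch_prob i 0 * ?e (Suc i)))"
      using branch_prob_le[OF x(2)] by (intro suminf_le summable_mult s x) auto
    also have "\<dots> = 2 * ?Q"
      by (rule suminf_mult) (rule s, simp)
    finally show "transfer ?u x \<le> 2 * ?Q" .
  qed simp
  also have "\<dots> = 2 * ?Q" by (simp add: gauss.prob_space)
  finally show ?thesis .
qed

text \<open>The Gauss density is tempered, so digit replacement applies to it. Passing from the
  weighted sum \<open>Q\<close> to the tail probability costs a factor 2, which turns 16 into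
  32.\<close>

lemma digit_replacement_prob:
  fixes g :: "nat \<Rightarrow> real"
  assumes c: "0 < c" and M: "M \<le> c / 4" and k: "k < n"
  shows "measure \<gamma> {x \<in> space \<gamma>. \<bar>g (gauss_digits x 0)\<bar> > c} *
      measure \<gamma> {x \<in> space \<gamma>. \<bar>(\<Sum>j<n. g (gauss_digits x j)) - A\<bar> \<le> c / 4 \<and> \<bar>g (gauss_digits x k)\<bar> \<le> M} \<le>
    32 * measure \<gamma> {x \<in> space \<gamma>. \<bar>(\<Sum>j<n. g (gauss_digits x j)) - A\<bar> > c / 4 \<and> \<bar>g (gauss_digits x k)\<bar> > c}"
proof -
  let ?Q = "\<Sum>i. branch_prob i 0 * (if \<bar>g (Suc i)\<bar> > c then 1 else 0)"
  let ?G = "\<lambda>x. \<bar>(\<Sum>j<n. g (gauss_digits x j)) - A\<bar> \<le> c / 4 \<and> \<bar>g (gauss_digits x k)\<bar> \<le> M"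
  let ?B = "\<lambda>x. \<bar>(\<Sum>j<n. g (gauss_digits x j)) - A\<bar> > c / 4 \<and> \<bar>g (gauss_digits x k)\<bar> > c"
  define r where "r = n - k - 1"
  have n: "n = k + Suc r" using k by (simp add: r_def)
  have sQ: "summable (\<lambda>i. branch_prob i 0 * (if \<bar>g (Suc i)\<bar> > c then 1 else 0))"
    by (intro summable_branch_prob_mult[where B = 1]) auto
  have Q0: "0 \<le> ?Q" by (intro suminf_nonneg sQ) (auto intro: branch_prob_nonneg)
  have eq: "emeasure \<gamma> {x \<in> space \<gamma>. ?G x} =
      (\<integral>\<^sup>+x. ennreal (if ?G x then 1 / (ln 2 * (1 + x)) else 0) * indicator {0<..<1} x \<partial>lborel)"
    "emeasure \<gamma> {x \<in> space \<gamma>. ?B x} =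
      (\<integral>\<^sup>+x. ennreal (if ?B x then 1 / (ln 2 * (1 + x)) else 0) * indicator {0<..<1} x \<partial>lborel)"
    by (rule emeasure_gauss_eq_nn_integral, measurable)+
  have "ennreal ?Q * emeasure \<gamma> {x \<in> space \<gamma>. ?G x} \<le> 16 * emeasure \<gamma> {x \<in> space \<gamma>. ?B x}"
    unfolding eq unfolding n by (rule digit_replacement[OF tempered_gauss_density c M])
  then have "ennreal (?Q * measure \<gamma> {x \<in> space \<gamma>. ?G x}) \<le> ennreal (16 * measure \<gamma> {x \<in> space \<gamma>. ?B x})"
    using Q0 by (simp add: gauss.emeasure_eq_measure ennreal_mult)
  then have "?Q * measure \<gamma> {x \<in> space \<gamma>. ?G x} \<le> 16 * measure \<gamma> {x \<in> space \<gamma>. ?B x}"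
    by simp
  moreover have "measure \<gamma> {x \<in> space \<gamma>. \<bar>g (gauss_digits x 0)\<bar> > c} * measure \<gamma> {x \<in> space \<gamma>. ?G x} \<le>
      2 * ?Q * measure \<gamma> {x \<in> space \<gamma>. ?G x}"
    by (intro mult_right_mono tail_prob_le) simp
  ultimately show ?thesis by linarith
qed

text \<open>
  The expected number of large digits on the event that the sum is far from \<open>A\<close> is at least a
  multiple of \<open>n p\<close> by digit replacement, while its second moment is at most \<open>480 n p + (n p)\<^sup>2\<close>.
\<close>

lemma tail_le_deviation_prob:
  fixes g :: "nat \<Rightarrow> real" and A :: real and n :: nat
  assumes c: "0 < c" and M: "M \<le> c / 4"
  defines "\<delta> \<equiv> measure \<gamma> {x \<in> space \<gamma>. \<bar>(\<Sum>j<n. g (gauss_digits x j)) - A\<bar> > c / 4}"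
    and "p \<equiv> measure \<gamma> {x \<in> space \<gamma>. \<bar>g (gauss_digits x 0)\<bar> > c}"
  assumes PM: "measure \<gamma> {x \<in> space \<gamma>. \<bar>g (gauss_digits x 0)\<bar> > M} \<le> 1 / 4" and \<delta>: "\<delta> \<le> 1 / 4"
  shows "real n * p * (1 / 128 - 32 * \<delta>) \<le> 32 * 480 * \<delta>"
proof -
  let ?D = "\<lambda>x. \<bar>(\<Sum>j<n. g (gauss_digits x j)) - A\<bar> > c / 4"
  let ?e = "\<lambda>i. if \<bar>g i\<bar> > c then 1 else (0::real)"
  let ?N = "\<lambda>x. \<Sum>k<n. ?e (gauss_digits x k)"
  let ?d = "\<lambda>x. if ?D x then 1 else (0::real)"
  have D[measurable]: "Measurable.pred borel ?D" by measurable
  have b: "\<bar>?e i\<bar> \<le> 1" for i by simp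
  have p: "(\<integral>x. ?e (gauss_digits x 0) \<partial>\<gamma>) = p"
    unfolding p_def by (rule prob_eq_expectation[symmetric]) measurable

  have p0: "0 \<le> p" by (simp add: p_def)
  have single: "p / 64 \<le> (\<integral>x. ?d x * ?e (gauss_digits x k) \<partial>\<gamma>)" if k: "k < n" for k
  proof -
    let ?G = "\<lambda>x. \<bar>(\<Sum>j<n. g (gauss_digits x j)) - A\<bar> \<le> c / 4 \<and> \<bar>g (gauss_digits x k)\<bar> \<le> M"
    have "(\<integral>x. (if \<bar>g (gauss_digits x k)\<bar> > M then 1 else 0) \<partial>\<gamma>) =
        (\<integral>x. (if \<bar>g (gauss_digits x 0)\<bar> > M then 1 else 0::real) \<partial>\<gamma>)"
      by (rule integral_gauss_digits_shift[where C = 1 and g = "\<lambda>i. if \<bar>g i\<bar> > M then 1 else 0"]) auto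
    then have Mk: "measure \<gamma> {x \<in> space \<gamma>. \<bar>g (gauss_digits x k)\<bar> > M} \<le> 1 / 4"
      using PM by (simp add: prob_eq_expectation)
    have "1 = measure \<gamma> (space \<gamma>)" by (simp add: gauss.prob_space)
    also have "\<dots> \<le> measure \<gamma> ({x \<in> space \<gamma>. ?D x} \<union> {x \<in> space \<gamma>. \<bar>g (gauss_digits x k)\<bar> > M} \<union> {x \<in> space \<gamma>. ?G x})"
      by (intro gauss.finite_measure_mono sets.Un sets_gauss_Collect) (auto, measurable)
    also have "\<dots> \<le> \<delta> + measure \<gamma> {x \<in> space \<gamma>. \<bar>g (gauss_digits x k)\<bar> > M} + measure \<gamma> {x \<in> space \<gamma>. ?G x}"
      unfolding \<delta>_def
      by (intro order_trans[OF measure_Un_le] add_right_mono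
          measure_Un_le sets.Un sets_gauss_Collect) measurable
    \<comment> \<open>What remains after removing two events of probability at most 1/4. Together
      with the factor 32 of the replacement this produces \<open>p / 64\<close>.\<close>
    finally have "1 / 2 \<le> measure \<gamma> {x \<in> space \<gamma>. ?G x}" using Mk \<delta> by linarith
    from mult_left_mono[OF this p0] digit_replacement_prob[OF c M k, of g A]
    have "p / 2 \<le> 32 * measure \<gamma> {x \<in> space \<gamma>. ?D x \<and> \<bar>g (gauss_digits x k)\<bar> > c}"
      by (simp add: p_def)
    also have "measure \<gamma> {x \<in> space \<gamma>. ?D x \<and> \<bar>g (gauss_digits x k)\<bar> > c} =
        (\<integral>x. (if ?D x \<and> \<bar>g (gauss_digits x k)\<bar> > c then 1 else 0) \<partial>\<gamma>)"
      by (rule prob_eq_expectation) measurable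
    also have "\<dots> = (\<integral>x. ?d x * ?e (gauss_digits x k) \<partial>\<gamma>)"
      by (intro Bochner_Integration.integral_cong) auto
    finally show ?thesis by simp
  qed
  define x where "x = real n * p"
  have x0: "0 \<le> x" using p0 by (simp add: x_def)
  have Nb: "\<bar>?N z\<bar> \<le> real n" for z
    using sum_abs[of "\<lambda>k. ?e (gauss_digits z k)" "{..<n}"]
      sum_mono[of "{..<n}" "\<lambda>k. \<bar>?e (gauss_digits z k)\<bar>" "\<lambda>_. 1"] by simp
  have iN: "integrable \<gamma> ?N" by (rule integrable_gauss_bounded[OF _ Nb]) measurable
  have iN2: "integrable \<gamma> (\<lambda>z. (?N z)^2)"
  proof (rule integrable_gauss_bounded)
    fix z
    have "\<bar>?N z\<bar>^2 \<le> (real n)^2" by (intro power_mono Nb) simp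
    then show "\<bar>(?N z)^2\<bar> \<le> (real n)^2" by (simp only: power2_abs abs_power2)
  qed measurable
  have idN: "integrable \<gamma> (\<lambda>z. ?d z * ?N z)"
  proof (rule integrable_gauss_bounded)
    fix z
    show "\<bar>?d z * ?N z\<bar> \<le> real n" using Nb[of z] by (cases "?D z") simp_all
  qed measurable
  have id: "integrable \<gamma> ?d"
    by (intro integrable_gauss_bounded[where B = 1]) auto
  have EN: "(\<integral>z. ?N z \<partial>\<gamma>) = x"
    using integral_gauss_digits_shift[of ?e, OF b] integrable_digit_fun[of ?e, OF b]
    by (simp add: Bochner_Integration.integral_sum p x_def)
  have "(\<integral>z. (?N z - x)^2 \<partial>\<gamma>) \<le> 480 * x"
  proof -
    have "(\<integral>z. (\<Sum>k<n. ?e (gauss_digits z k) - p)^2 \<partial>\<gamma>) \<le> 480 * real n * (\<integral>z. (?e (gauss_digits z 0))^2 \<partial>\<gamma>)"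
      using digit_sum_variance_bound[of ?e, OF b] unfolding p .
    moreover have "(?e i)^2 = ?e i" for i by simp
    moreover have "(\<Sum>k<n. ?e (gauss_digits z k) - p) = ?N z - x" for z
      by (simp only: sum_subtractf) (simp add: x_def)
    ultimately show ?thesis by (simp only: p) (simp only: x_def mult.assoc)
  qed
  moreover have "(\<integral>z. (?N z - x)^2 \<partial>\<gamma>) = (\<integral>z. (?N z)^2 \<partial>\<gamma>) - x^2"
    using gauss.variance_eq[OF iN iN2] unfolding EN .
  ultimately have EN2: "(\<integral>z. (?N z)^2 \<partial>\<gamma>) \<le> 480 * x + x^2" by linarith
  \<comment> \<open>The weight in the pointwise inequality
    \<open>N <= t / 2 + N^2 / (2 * t)\<close>, a linearised Cauchy-Schwarz estimate. It is chosen so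
    that the second moment term is exactly \<open>x / 128\<close>, half of the lower bound
    \<open>x / 64\<close>.\<close>
  define t where "t = 64 * (480 + x)"
  have t: "0 < t" using x0 by (simp add: t_def)
  have "x / 64 = (\<Sum>k<n. p / 64)" by (simp add: x_def)
  also have "\<dots> \<le> (\<Sum>k<n. \<integral>z. ?d z * ?e (gauss_digits z k) \<partial>\<gamma>)"
    by (intro sum_mono single) simp
  also have "\<dots> = (\<integral>z. (\<Sum>k<n. ?d z * ?e (gauss_digits z k)) \<partial>\<gamma>)"
    by (intro Bochner_Integration.integral_sum[symmetric] integrable_gauss_bounded[where B = 1]) auto
  also have "\<dots> = (\<integral>z. ?d z * ?N z \<partial>\<gamma>)"
    by (simp only: sum_distrib_left)
  also have "\<dots> \<le> (\<integral>z. t / 2 * ?d z + (?N z)^2 / (2 * t) \<partial>\<gamma>)"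
  proof (rule integral_mono)
    fix z
    have "0 \<le> (t - ?N z)^2 / (2 * t)" using t by auto
    also have "\<dots> = t / 2 + (?N z)^2 / (2 * t) - ?N z"
      using t by (simp add: power2_eq_square field_simps)
    finally have "?N z \<le> t / 2 + (?N z)^2 / (2 * t)" by simp
    moreover have "0 \<le> (?N z)^2 / (2 * t)" using t by auto
    ultimately show "?d z * ?N z \<le> t / 2 * ?d z + (?N z)^2 / (2 * t)" by (cases "?D z") simp_all
  qed (use idN id iN2 in auto)
  also have "\<dots> = t / 2 * \<delta> + (\<integral>z. (?N z)^2 \<partial>\<gamma>) / (2 * t)"
    using id iN2 unfolding \<delta>_def prob_eq_expectation[OF D] by simp
  also have "\<dots> \<le> t / 2 * \<delta> + (480 * x + x^2) / (2 * t)"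
    using EN2 t by (intro add_left_mono divide_right_mono) auto
  also have "(480 * x + x^2) / (2 * t) = x / 128"
    using x0 by (simp add: t_def power2_eq_square field_simps)
  finally have "x / 64 \<le> t / 2 * \<delta> + x / 128" .
  moreover have "t / 2 * \<delta> = 32 * 480 * \<delta> + x * (32 * \<delta>)"
    by (simp add: t_def algebra_simps)
  ultimately show ?thesis
    unfolding x_def[symmetric] right_diff_distrib by linarith
qed

subsection \<open>Slow variation\<close>

text \<open>Dominated convergence turns convergence for each \<open>v\<close> into small measure of
  the exceptional set. The window [0, 2] is wide enough to contain both \<open>v\<close> and
  \<open>v - u\<close> for \<open>v\<close> in [1, 2] and \<open>u\<close> in [0, 1].\<close>

lemma asymptotically_invariant_small_measure:
  fixes k :: "real \<Rightarrow> real"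
  assumes [measurable]: "k \<in> borel_measurable borel"
    and inv: "\<And>v. ((\<lambda>t. k (t + v) - k t) \<longlongrightarrow> 0) at_top"
    and s: "filterlim s at_top sequentially" and "0 < \<epsilon>"
  shows "(\<lambda>n. \<integral>v. indicator {v \<in> {0..2}. \<bar>k (s n + v) - k (s n)\<bar> \<ge> \<epsilon>} v \<partial>lborel) \<longlonglongrightarrow> (0::real)"
proof -
  have "(\<lambda>n. \<integral>v. indicator {v \<in> {0..2}. \<bar>k (s n + v) - k (s n)\<bar> \<ge> \<epsilon>} v \<partial>lborel) \<longlonglongrightarrow> (\<integral>v. (0::real) \<partial>(lborel::real measure))"
  proof (rule integral_dominated_convergence[where w = "indicator {0..2}"])
    show "AE v in lborel. (\<lambda>n. indicator {v \<in> {0..2}. \<bar>k (s n + v) - k (s n)\<bar> \<ge> \<epsilon>} v) \<longlonglongrightarrow> (0::real)"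
    proof (rule AE_I2)
      fix v :: real
      have "(\<lambda>n. k (s n + v) - k (s n)) \<longlonglongrightarrow> 0"
        by (rule filterlim_compose[OF inv s])
      then have "eventually (\<lambda>n. \<bar>k (s n + v) - k (s n)\<bar> < \<epsilon>) sequentially"
        using \<open>0 < \<epsilon>\<close> by (auto simp: tendsto_iff dist_real_def)
      then show "(\<lambda>n. indicator {v \<in> {0..2}. \<bar>k (s n + v) - k (s n)\<bar> \<ge> \<epsilon>} v) \<longlonglongrightarrow> (0::real)"
        by (intro tendsto_eventually) (auto elim!: eventually_mono simp: indicator_def)
    qed
  qed (auto simp: indicator_def)
  then show ?thesis by simp
qed

text \<open>
  Karamata's uniform convergence theorem in additive form. For large \<open>n\<close> the exceptional
  sets of \<open>t n\<close> and of \<open>t n + u n\<close>, the latter shifted by \<open>u n\<close>, cannot cover \<open>[1, 2]\<close>.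
\<close>

lemma asymptotically_invariant_uniform:
  fixes k :: "real \<Rightarrow> real"
  assumes [measurable]: "k \<in> borel_measurable borel"
    and inv: "\<And>v. ((\<lambda>t. k (t + v) - k t) \<longlongrightarrow> 0) at_top"
    and t: "filterlim t at_top sequentially" and u: "\<And>n. u n \<in> {0..1}"
  shows "(\<lambda>n. k (t n + u n) - k (t n)) \<longlonglongrightarrow> 0"
proof (rule tendstoI)
  fix e :: real assume "0 < e"
  define \<epsilon> where "\<epsilon> = e / 2"
  have \<epsilon>: "0 < \<epsilon>" using \<open>0 < e\<close> by (simp add: \<epsilon>_def)
  define J where "J s = (indicator {v \<in> {0..2}. \<bar>k (s + v) - k s\<bar> \<ge> \<epsilon>} :: real \<Rightarrow> real)" for s
  have [measurable]: "J s \<in> borel_measurable borel" for s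
    unfolding J_def by measurable
  have int_J: "integrable lborel (J s)" for s
  proof (rule Bochner_Integration.integrable_bound)
    show "integrable lborel (indicator {0..2} :: real \<Rightarrow> real)" by simp
  qed (auto simp: J_def indicator_def)
  have tu: "filterlim (\<lambda>n. t n + u n) at_top sequentially"
    by (rule filterlim_at_top_mono[OF t]) (use u in auto)
  have "eventually (\<lambda>n. (\<integral>v. J (t n) v \<partial>lborel) < 1 / 2) sequentially"
    "eventually (\<lambda>n. (\<integral>v. J (t n + u n) v \<partial>lborel) < 1 / 2) sequentially"
    unfolding J_def
    by (rule order_tendstoD(2)[OF asymptotically_invariant_small_measure[OF assms(1) inv _ \<epsilon>]], fact, simp)+
  then show "eventually (\<lambda>n. dist (k (t n + u n) - k (t n)) 0 < e) sequentially"
  proof eventually_elim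
    case (elim n)
    have "\<exists>v\<in>{1..2}. J (t n) v = 0 \<and> J (t n + u n) (v - u n) = 0"
    proof (rule ccontr)
      assume *: "\<not> ?thesis"
      have shift: "(\<integral>v. J (t n + u n) v \<partial>lborel) = (\<integral>v. J (t n + u n) (- u n + 1 * v) \<partial>lborel)"
        "integrable lborel (\<lambda>v. J (t n + u n) (- u n + 1 * v))"
        using lborel_integral_real_affine[of 1 "J (t n + u n)" "- u n"]
          lborel_integrable_real_affine[OF int_J, of 1 "t n + u n" "- u n"] by simp_all
      have "1 = (\<integral>v. indicator {1..2::real} v \<partial>lborel :: real)" by simp
      also have "\<dots> \<le> (\<integral>v. J (t n) v + J (t n + u n) (- u n + 1 * v) \<partial>lborel)"
      proof (rule integral_mono)
        fix v :: real
        have "J (t n) v = 0 \<or> J (t n) v = 1" "J (t n + u n) (v - u n) = 0 \<or> J (t n + u n) (v - u n) = 1"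
          by (auto simp: J_def indicator_def)
        then show "indicator {1..2} v \<le> J (t n) v + J (t n + u n) (- u n + 1 * v)"
          using * by (cases "v \<in> {1..2}") auto
      qed (use int_J shift in auto)
      also have "\<dots> = (\<integral>v. J (t n) v \<partial>lborel) + (\<integral>v. J (t n + u n) v \<partial>lborel)"
        unfolding shift(1) by (intro Bochner_Integration.integral_add int_J shift)
      finally show False using elim by simp
    qed
    then obtain v where v: "v \<in> {1..2}" "J (t n) v = 0" "J (t n + u n) (v - u n) = 0" by blast
    have "v \<in> {0..2}" "v - u n \<in> {0..2}" using v(1) u[of n] by auto
    with v(2,3) have "\<bar>k (t n + v) - k (t n)\<bar> < \<epsilon>" "\<bar>k (t n + u n + (v - u n)) - k (t n + u n)\<bar> < \<epsilon>"
      by (auto simp: J_def indicator_def split: if_splits)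
    \<comment> \<open>Both increments end at the same point \<open>t n + v\<close>, so their
      difference is the increment from \<open>t n\<close> to \<open>t n + u n\<close>.\<close>
    then show ?case by (simp add: \<epsilon>_def dist_real_def abs_if split: if_splits)
  qed
qed

text \<open>The factor \<open>U n\<close> moves with \<open>n\<close>, so the defining limits for
  fixed factors are not enough. Passing to \<open>k t = ln (h (exp t))\<close> makes the problem
  additive, with shifts \<open>ln (U n)\<close> in [0, 1].\<close>

lemma slowly_varying_uniform:
  fixes h :: "real \<Rightarrow> real"
  assumes h: "slowly_varying h" and X: "filterlim X at_top sequentially"
    and U: "\<And>n. U n \<in> {1..2}"
  shows "(\<lambda>n. h (U n * X n) / h (X n)) \<longlonglongrightarrow> 1"
proof -
  define k where "k t = ln (h (exp t))" for t
  have pos: "\<And>x. x > 0 \<Longrightarrow> h x > 0"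
    and meas: "h \<in> borel_measurable (restrict_space borel {0<..})"
    and lim: "\<And>u. u > 0 \<Longrightarrow> ((\<lambda>x. h (u * x) / h x) \<longlongrightarrow> 1) at_top"
    using h by (auto simp: slowly_varying_def)
  have "(\<lambda>t. h (exp t)) \<in> borel_measurable borel"
    by (rule measurable_compose[OF measurable_restrict_space2 meas]) auto
  then have 1: "k \<in> borel_measurable borel" unfolding k_def by measurable
  have 2: "((\<lambda>t. k (t + v) - k t) \<longlongrightarrow> 0) at_top" for v
  proof -
    have "((\<lambda>t. ln (h (exp v * exp t) / h (exp t))) \<longlongrightarrow> ln 1) at_top"
      by (intro tendsto_ln filterlim_compose[OF lim exp_at_top]) auto
    moreover have "ln (h (exp v * exp t) / h (exp t)) = k (t + v) - k t" for t
      using pos[of "exp v * exp t"] pos[of "exp t"] by (simp add: k_def ln_div exp_add mult.commute)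
    ultimately show ?thesis by simp
  qed
  have 3: "filterlim (\<lambda>n. ln (X n)) at_top sequentially"
    by (rule filterlim_compose[OF ln_at_top X])
  have 4: "ln (U n) \<in> {0..1}" for n
  proof -
    have "ln (U n) \<le> U n - 1" using U[of n] by (intro ln_le_minus_one) auto
    moreover have "0 \<le> ln (U n)" using U[of n] by (intro ln_ge_zero) auto
    ultimately show ?thesis using U[of n] by auto
  qed
  have "(\<lambda>n. exp (k (ln (X n) + ln (U n)) - k (ln (X n)))) \<longlonglongrightarrow> exp 0"
    by (intro tendsto_exp asymptotically_invariant_uniform[OF 1 2 3 4])
  moreover have "eventually (\<lambda>n. exp (k (ln (X n) + ln (U n)) - k (ln (X n))) = h (U n * X n) / h (X n)) sequentially"
    using filterlim_at_top_dense[THEN iffD1, OF X, rule_format, of 0]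
  proof eventually_elim
    case (elim n)
    have "0 < U n" using U[of n] by auto
    then show ?case using elim pos by (simp add: k_def exp_diff exp_add mult.commute)
  qed
  ultimately show ?thesis by (simp add: tendsto_cong)
qed

text \<open>Subtracting a small constant absorbs the error term and leaves a purely multiplicative
  recursion. This first bounds the sequence and then gives a factor \<open>\<rho> ^ j\<close> after
  \<open>j\<close> halvings.\<close>

lemma halving_recursion_tendsto_0:
  fixes x e :: "nat \<Rightarrow> real"
  assumes nn: "\<And>n. 0 \<le> x n" and \<rho>: "0 \<le> \<rho>" "\<rho> < 1" and e: "e \<longlonglongrightarrow> 0"
    and rec: "eventually (\<lambda>n. x n \<le> \<rho> * x ((n + 1) div 2) + e n) sequentially"
  shows "x \<longlonglongrightarrow> 0"
proof (rule tendstoI)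
  fix r :: real assume "0 < r"
  define \<epsilon> where "\<epsilon> = r / 2"
  have \<epsilon>: "0 < \<epsilon>" using \<open>0 < r\<close> by (simp add: \<epsilon>_def)
  \<comment> \<open>The threshold makes \<open>\<epsilon>\<close> the fixed point of the map taking
    z to \<open>\<rho> * z + \<epsilon> * (1 - \<rho>)\<close>.\<close>
  have "eventually (\<lambda>n. e n < \<epsilon> * (1 - \<rho>)) sequentially"
    using \<epsilon> \<rho> by (intro order_tendstoD(2)[OF e]) auto
  with rec have "eventually (\<lambda>n. x n - \<epsilon> \<le> \<rho> * (x ((n + 1) div 2) - \<epsilon>)) sequentially"
    by eventually_elim (simp add: algebra_simps)
  then obtain N0 where N0: "\<And>n. N0 \<le> n \<Longrightarrow> x n - \<epsilon> \<le> \<rho> * (x ((n + 1) div 2) - \<epsilon>)"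
    by (auto simp: eventually_sequentially)
  \<comment> \<open>From 2 on, \<open>(n + 1) div 2\<close> is strictly less than \<open>n\<close>,
    as the strong induction requires.\<close>
  define N where "N = max N0 2"
  define K where "K = (\<Sum>m<N. x m)"
  have K0: "0 \<le> K" using nn by (auto simp: K_def intro: sum_nonneg)
  have *: "x n - \<epsilon> \<le> K" for n
  proof (induction n rule: less_induct)
    case (less n)
    show ?case
    proof (cases "n < N")
      case True
      then have "x n \<le> K" using nn unfolding K_def by (intro member_le_sum) auto
      then show ?thesis using \<epsilon> by simp
    next
      case False
      have "x n - \<epsilon> \<le> \<rho> * (x ((n + 1) div 2) - \<epsilon>)" using False by (intro N0) (auto simp: N_def)
      also have "\<dots> \<le> \<rho> * K" using False \<rho> by (intro mult_left_mono less.IH) (auto simp: N_def)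
      also have "\<dots> \<le> K" using K0 \<rho> by (simp add: mult_left_le_one_le)
      finally show ?thesis .
    qed
  qed
  have **: "x n - \<epsilon> \<le> K * \<rho> ^ j" if "2 ^ j * N \<le> n" for n j
    using that
  proof (induction j arbitrary: n)
    case 0
    then show ?case using * by simp
  next
    case (Suc j)
    have "N \<le> 2 ^ Suc j * N" by simp
    then have "N0 \<le> n" using Suc.prems by (simp add: N_def)
    then have "x n - \<epsilon> \<le> \<rho> * (x ((n + 1) div 2) - \<epsilon>)" by (rule N0)
    also have "\<dots> \<le> \<rho> * (K * \<rho> ^ j)"
      using Suc.prems \<rho> by (intro mult_left_mono Suc.IH) auto
    finally show ?case by (simp add: mult_ac)
  qed
  have "(\<lambda>j. K * \<rho> ^ j) \<longlonglongrightarrow> K * 0"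
    using \<rho> by (intro tendsto_intros LIMSEQ_realpow_zero) auto
  then have "eventually (\<lambda>j. K * \<rho> ^ j < \<epsilon>) sequentially"
    using \<epsilon> by (intro order_tendstoD(2)) auto
  then obtain j where j: "K * \<rho> ^ j < \<epsilon>" by (auto simp: eventually_sequentially)
  show "eventually (\<lambda>n. dist (x n) 0 < r) sequentially"
    using eventually_ge_at_top[of "2 ^ j * N"]
  proof eventually_elim
    case (elim n)
    from **[OF elim] j have "x n < r" by (simp add: \<epsilon>_def)
    then show ?case using nn[of n] by (simp add: dist_real_def)
  qed
qed

section \<open>Regular variation of \<open>c\<close> along halving\<close>

lemma half_ratio_tendsto: "(\<lambda>n. real n / real ((n + 1) div 2)) \<longlonglongrightarrow> 2"
proof (rule tendsto_sandwich[of "\<lambda>n. 2 - 2 / (real n + 1)" _ _ "\<lambda>n. 2"])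
  have b: "real n \<le> 2 * real ((n + 1) div 2)" "2 * real ((n + 1) div 2) \<le> real n + 1" for n
    by linarith+
  show "\<forall>\<^sub>F n in sequentially. real n / real ((n + 1) div 2) \<le> 2"
    using eventually_gt_at_top[of 0] by eventually_elim (use b in \<open>auto simp: field_simps\<close>)
  show "\<forall>\<^sub>F n in sequentially. 2 - 2 / (real n + 1) \<le> real n / real ((n + 1) div 2)"
    using eventually_gt_at_top[of 0]
  proof eventually_elim
    case (elim n)
    have q: "0 < real ((n + 1) div 2)" using elim by simp
    have "2 - 2 / (real n + 1) = 2 * real n / (real n + 1)" by (simp add: field_simps)
    also have "\<dots> \<le> 2 * real n / (2 * real ((n + 1) div 2))"
      using b[of n] q by (intro divide_left_mono) auto
    finally show ?case by simp
  qed
  show "(\<lambda>n. 2 - 2 / (real n + 1)) \<longlonglongrightarrow> 2" by real_asymp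
qed simp

lemma filterlim_half: "filterlim (\<lambda>n::nat. (n + 1) div 2) at_top sequentially"
  unfolding filterlim_at_top
proof
  fix Z :: nat
  show "\<forall>\<^sub>F n in sequentially. Z \<le> (n + 1) div 2"
    using eventually_ge_at_top[of "2 * Z"] by eventually_elim linarith
qed

text \<open>For odd \<open>n\<close> the ratio of \<open>n\<close> to \<open>(n + 1) div 2\<close>
  is not 2 but only close to it. It always lies in [1, 2], so the uniform statement applies along
  the points \<open>(n + 1) div 2\<close>.\<close>

lemma regularly_varying_half_ratio:
  fixes h :: "real \<Rightarrow> real" and c :: "nat \<Rightarrow> real"
  assumes r: "0 < r" and h: "slowly_varying h"
    and c: "\<And>n. 1 \<le> n \<Longrightarrow> c n = real n powr (1 / r) * h (real n)"
  shows "(\<lambda>n. c ((n + 1) div 2) / c n) \<longlonglongrightarrow> (1 / 2) powr (1 / r)"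
proof -
  let ?q = "\<lambda>n::nat. (n + 1) div 2"
  \<comment> \<open>The value at 0 is a dummy that keeps every \<open>U n\<close> in [1, 2].\<close>
  define U where "U n = (if n = 0 then 1 else real n / real (?q n))" for n
  have hpos: "\<And>x. x > 0 \<Longrightarrow> h x > 0" using h by (auto simp: slowly_varying_def)
  have U: "U n \<in> {1..2}" for n
  proof (cases "n = 0")
    case False
    then have "0 < real (?q n)" "real (?q n) \<le> real n" "real n \<le> 2 * real (?q n)" by linarith+
    then show ?thesis using False by (auto simp: U_def field_simps)
  qed (simp add: U_def)
  have q: "filterlim (\<lambda>n. real (?q n)) at_top sequentially"
    by (rule filterlim_compose[OF filterlim_real_sequentially filterlim_half])
  have "(\<lambda>n. inverse (U n) powr (1 / r) * inverse (h (U n * real (?q n)) / h (real (?q n)))) \<longlonglongrightarrow>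
      inverse 2 powr (1 / r) * inverse 1"
  proof (intro tendsto_intros slowly_varying_uniform[OF h q U])
    show "U \<longlonglongrightarrow> 2"
      by (rule Lim_transform_eventually[OF half_ratio_tendsto])
        (auto intro!: eventually_mono[OF eventually_gt_at_top[of 0]] simp: U_def)
  qed auto
  moreover have "eventually (\<lambda>n. inverse (U n) powr (1 / r) * inverse (h (U n * real (?q n)) / h (real (?q n))) =
      c (?q n) / c n) sequentially"
    using eventually_gt_at_top[of 0]
  proof eventually_elim
    case (elim n)
    have q0: "0 < ?q n" using elim by simp
    have U_eq: "inverse (U n) = real (?q n) / real n" "U n * real (?q n) = real n"
      using elim q0 by (auto simp: U_def)
    have "inverse (U n) powr (1 / r) = real (?q n) powr (1 / r) / real n powr (1 / r)"
      unfolding U_eq by (rule powr_divide)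
    moreover have "c n = real n powr (1 / r) * h (real n)" "c (?q n) = real (?q n) powr (1 / r) * h (real (?q n))"
      using elim q0 by (auto intro!: c)
    ultimately show ?case
      unfolding U_eq by simp
  qed
  ultimately show ?thesis by (simp add: tendsto_cong)
qed

text \<open>The halving recursion, with zero error, applied to \<open>1 / c n\<close>: the ratio of
  \<open>c\<close> at the upper half of \<open>n\<close> to \<open>c n\<close> has a limit below
  1.\<close>

lemma regularly_varying_at_top:
  fixes h :: "real \<Rightarrow> real" and c :: "nat \<Rightarrow> real"
  assumes r: "0 < r" and h: "slowly_varying h"
    and c: "\<And>n. 1 \<le> n \<Longrightarrow> c n = real n powr (1 / r) * h (real n)"
  shows "filterlim c at_top sequentially"
proof -
  have cpos: "0 < c n" if "1 \<le> n" for n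
    using c[OF that] h that by (auto simp: slowly_varying_def)
  define \<rho> where "\<rho> = ((1 / 2) powr (1 / r) + 1) / 2"
  have "(1 / 2) powr (1 / r) < (1 / 2 :: real) powr 0"
    using r by (intro powr_less_mono') auto
  then have lt: "(1 / 2) powr (1 / r) < (1::real)" by simp
  \<comment> \<open>The absolute value secures nonnegativity also at \<open>n = 0\<close>, where the
    sign of \<open>c\<close> is unknown.\<close>
  define x where "x n = \<bar>inverse (c n)\<bar>" for n
  have "x \<longlonglongrightarrow> 0"
  proof (rule halving_recursion_tendsto_0[where e = "\<lambda>_. 0" and \<rho> = \<rho>])
    show "0 \<le> x n" for n by (simp add: x_def)
    show "0 \<le> \<rho>" by (simp add: \<rho>_def)
    show "\<rho> < 1" using lt by (simp add: \<rho>_def)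
    have "(1 / 2) powr (1 / r) < \<rho>" using lt by (simp add: \<rho>_def)
    moreover have "(\<lambda>n. c ((n + 1) div 2) / c n) \<longlonglongrightarrow> (1 / 2) powr (1 / r)"
      by (rule regularly_varying_half_ratio[OF r h c])
    ultimately have "eventually (\<lambda>n. c ((n + 1) div 2) / c n < \<rho>) sequentially"
      by (intro order_tendstoD(2))
    then show "\<forall>\<^sub>F n in sequentially. x n \<le> \<rho> * x ((n + 1) div 2) + 0"
      using eventually_ge_at_top[of 1]
    proof eventually_elim
      case (elim n)
      have "0 < c n" "0 < c ((n + 1) div 2)" using elim by (auto intro!: cpos)
      then show ?case using elim by (simp add: x_def field_simps)
    qed
  qed simp
  then have "(\<lambda>n. inverse (c n)) \<longlonglongrightarrow> 0" unfolding x_def by (rule tendsto_rabs_zero_cancel)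
  then have "filterlim (\<lambda>n. inverse (inverse (c n))) at_top sequentially"
    by (rule filterlim_inverse_at_top)
      (auto intro!: eventually_mono[OF eventually_ge_at_top[of 1]] cpos)
  then show ?thesis by simp
qed

subsection \<open>The weak law\<close>

lemma truncated_second_moment_tendsto_0:
  fixes g :: "nat \<Rightarrow> real" and h :: "real \<Rightarrow> real" and c :: "nat \<Rightarrow> real"
  assumes r: "0 < r" "r < 2" and h: "slowly_varying h"
    and c: "\<And>n. 1 \<le> n \<Longrightarrow> c n = real n powr (1 / r) * h (real n)"
    and tail: "(\<lambda>n. real n * measure \<gamma> {x \<in> space \<gamma>. \<bar>g (gauss_digits x 0)\<bar> > c n}) \<longlonglongrightarrow> 0"
  shows "(\<lambda>n. real n * (\<integral>x. (if \<bar>g (gauss_digits x 0)\<bar> \<le> c n then g (gauss_digits x 0) else 0)^2 \<partial>\<gamma>) / (c n)^2) \<longlonglongrightarrow> 0"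
proof -
  let ?q = "\<lambda>n::nat. (n + 1) div 2"
  let ?X = "\<lambda>n x. if \<bar>g (gauss_digits x 0)\<bar> \<le> c n then g (gauss_digits x 0) else 0"
  define p where "p n = measure \<gamma> {x \<in> space \<gamma>. \<bar>g (gauss_digits x 0)\<bar> > c n}" for n
  define m where "m n = (\<integral>x. (?X n x)^2 \<partial>\<gamma>)" for n
  define B where "B n = real n * m n / (c n)^2" for n
  have cpos: "0 < c n" if "1 \<le> n" for n
    using c[OF that] h that by (auto simp: slowly_varying_def)
  have m0: "0 \<le> m n" and p0: "0 \<le> p n" for n by (simp_all add: m_def p_def)
  have int_X: "integrable \<gamma> (\<lambda>x. (?X n x)^2)" for n
  proof (rule integrable_gauss_bounded)
    fix x show "\<bar>(?X n x)^2\<bar> \<le> (c n)^2"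
      using abs_le_square_iff[of "g (gauss_digits x 0)" "c n"] by auto
  qed measurable
  have int_e: "integrable \<gamma> (\<lambda>x. if \<bar>g (gauss_digits x 0)\<bar> > c k then 1 else (0::real))" for k
    by (rule integrable_gauss_bounded[where B = 1]) auto
  \<comment> \<open>Where the value is at most \<open>c k\<close>, the truncation at
    \<open>c n\<close> is dominated by the one at \<open>c k\<close>; elsewhere its square is at
    most \<open>(c n)^2\<close>. No order between \<open>c k\<close> and \<open>c n\<close> is
    assumed.\<close>
  have m_rec: "m n \<le> m k + (c n)^2 * p k" if n: "1 \<le> n" for n k
  proof -
    have "m n \<le> (\<integral>x. (?X k x)^2 + (c n)^2 * (if \<bar>g (gauss_digits x 0)\<bar> > c k then 1 else 0) \<partial>\<gamma>)"
      unfolding m_def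
    proof (rule integral_mono)
      fix x
      show "(?X n x)^2 \<le> (?X k x)^2 + (c n)^2 * (if \<bar>g (gauss_digits x 0)\<bar> > c k then 1 else 0)"
        using abs_le_square_iff[of "g (gauss_digits x 0)" "c n"] cpos[OF n] by auto
    qed (intro int_X Bochner_Integration.integrable_add integrable_mult_right int_e)+
    also have "\<dots> = m k + (c n)^2 * p k"
      unfolding m_def p_def
      by (subst prob_eq_expectation, measurable)
        (simp only: Bochner_Integration.integral_add int_X integrable_mult_right int_e integral_mult_right_zero)
    finally show ?thesis .
  qed
  have coef: "(\<lambda>n. real n / real (?q n) * (c (?q n) / c n)^2) \<longlonglongrightarrow> 2 * ((1 / 2) powr (1 / r))^2"
    by (intro tendsto_intros half_ratio_tendsto regularly_varying_half_ratio[OF r(1) h c])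
  \<comment> \<open>The limit of the recursion coefficient is \<open>2 powr (1 - 2 / r)\<close>,
    which is below 1 because \<open>r < 2\<close>.\<close>
  have "2 * ((1 / 2) powr (1 / r))^2 < (1::real)"
  proof -
    have "((1 / 2) powr (1 / r))^2 = (1 / 2 :: real) powr (2 / r)"
      by (simp add: powr_power)
    also have "\<dots> < (1 / 2) powr 1"
      using r by (intro powr_less_mono') auto
    finally show ?thesis by simp
  qed
  then obtain \<rho> where \<rho>: "2 * ((1 / 2) powr (1 / r))^2 < \<rho>" "\<rho> < 1" using dense by blast
  have ev: "eventually (\<lambda>n. real n / real (?q n) * (c (?q n) / c n)^2 < \<rho>) sequentially"
    by (rule order_tendstoD(2)[OF coef \<rho>(1)])
  have "B \<longlonglongrightarrow> 0"
  proof (rule halving_recursion_tendsto_0)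
    show "0 \<le> B n" for n using m0 by (simp add: B_def)
    show "0 \<le> \<rho>" by (rule order_trans[OF _ less_imp_le[OF \<rho>(1)]]) simp
    show "\<rho> < 1" by fact
    have "(\<lambda>n. 2 * (real (?q n) * p (?q n))) \<longlonglongrightarrow> 2 * 0"
      unfolding p_def by (intro tendsto_intros filterlim_compose[OF tail filterlim_half])
    then show "(\<lambda>n. 2 * (real (?q n) * p (?q n))) \<longlonglongrightarrow> 0" by simp
    show "\<forall>\<^sub>F n in sequentially. B n \<le> \<rho> * B (?q n) + 2 * (real (?q n) * p (?q n))"
      using ev eventually_ge_at_top[of 1]
    proof eventually_elim
      case (elim n)
      have q1: "1 \<le> ?q n" using elim by simp
      have cn: "0 < c n" "0 < c (?q n)" using cpos elim q1 by auto
      have B0: "0 \<le> B (?q n)" using m0 by (simp add: B_def)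
      have "B n \<le> real n * (m (?q n) + (c n)^2 * p (?q n)) / (c n)^2"
        unfolding B_def using m_rec[OF elim(2)] by (intro divide_right_mono mult_left_mono) auto
      also have "\<dots> = real n * m (?q n) / (c n)^2 + real n * p (?q n)"
        using cn by (simp add: add_divide_distrib distrib_left)
      also have "real n * m (?q n) / (c n)^2 = real n / real (?q n) * (c (?q n) / c n)^2 * B (?q n)"
        unfolding B_def using cn q1 by (simp add: power_divide)
      also have "\<dots> \<le> \<rho> * B (?q n)" using elim(1) B0 by (intro mult_right_mono) auto
      also have "real n * p (?q n) \<le> 2 * (real (?q n) * p (?q n))"
      proof -
        have "real n \<le> 2 * real (?q n)" by linarith
        then have "real n * p (?q n) \<le> 2 * real (?q n) * p (?q n)" by (intro mult_right_mono p0)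
        then show ?thesis by simp
      qed
      finally show ?case by simp
    qed
  qed
  then show ?thesis unfolding B_def m_def .
qed

text \<open>The centering is exactly the mean of the truncated digit function, so truncation leaves
  no bias. Unless one of the \<open>n\<close> digits exceeds the level, the sum equals the centered
  truncated sum; the exceptional event is handled by a union bound.\<close>

lemma weak_law_gauss_digits_sufficient:
  fixes g :: "nat \<Rightarrow> real" and h :: "real \<Rightarrow> real" and c :: "nat \<Rightarrow> real"
  assumes r: "0 < r" "r < 2" and h: "slowly_varying h"
    and c: "\<And>n. 1 \<le> n \<Longrightarrow> c n = real n powr (1 / r) * h (real n)"
    and tail: "(\<lambda>n. real n * measure \<gamma> {x \<in> space \<gamma>. \<bar>g (gauss_digits x 0)\<bar> > c n}) \<longlonglongrightarrow> 0"
    and \<epsilon>: "0 < \<epsilon>"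
  shows "(\<lambda>n. measure \<gamma> {x \<in> space \<gamma>. \<bar>inverse (c n) * (\<Sum>k<n. g (gauss_digits x k) -
    (\<integral>y. (if \<bar>g (gauss_digits y 0)\<bar> \<le> c n then g (gauss_digits y 0) else 0) \<partial>\<gamma>))\<bar> > \<epsilon>}) \<longlonglongrightarrow> 0"
proof -
  define t where "t n i = (if \<bar>g i\<bar> \<le> c n then g i else 0)" for n i
  define b where "b n = (\<integral>y. t n (gauss_digits y 0) \<partial>\<gamma>)" for n
  define p where "p n = measure \<gamma> {x \<in> space \<gamma>. \<bar>g (gauss_digits x 0)\<bar> > c n}" for n
  define m where "m n = (\<integral>x. (t n (gauss_digits x 0))^2 \<partial>\<gamma>)" for n
  let ?P = "\<lambda>n. measure \<gamma> {x \<in> space \<gamma>. \<bar>inverse (c n) * (\<Sum>k<n. g (gauss_digits x k) - b n)\<bar> > \<epsilon>}"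
  have cpos: "0 < c n" if "1 \<le> n" for n
    using c[OF that] h that by (auto simp: slowly_varying_def)
  have bound: "?P n \<le> real n * p n + 480 / \<epsilon>^2 * (real n * m n / (c n)^2)" if n: "1 \<le> n" for n
  proof -
    let ?Z = "\<lambda>x. \<Sum>k<n. t n (gauss_digits x k) - b n"
    let ?E = "\<lambda>k. {x \<in> space \<gamma>. \<bar>g (gauss_digits x k)\<bar> > c n}"
    let ?F = "{x \<in> space \<gamma>. (\<epsilon> * c n)^2 \<le> (?Z x)^2}"
    have tb: "\<bar>t n i\<bar> \<le> c n" for i using cpos[OF n] by (simp add: t_def)
    have abs_eq: "\<bar>inverse (c n) * z\<bar> = \<bar>z\<bar> / c n" for z
      using cpos[OF n] by (simp add: abs_mult divide_inverse mult.commute)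
    have E_sets: "?E k \<in> sets \<gamma>" for k by (rule sets_gauss_Collect) measurable
    have F_sets: "?F \<in> sets \<gamma>" by (rule sets_gauss_Collect) measurable
    have "measure \<gamma> (?E k) = p n" for k
    proof -
      have "(\<integral>x. (if \<bar>g (gauss_digits x k)\<bar> > c n then 1 else 0) \<partial>\<gamma>) =
          (\<integral>x. (if \<bar>g (gauss_digits x 0)\<bar> > c n then 1 else 0::real) \<partial>\<gamma>)"
        by (rule integral_gauss_digits_shift[where C = 1 and g = "\<lambda>i. if \<bar>g i\<bar> > c n then 1 else 0"]) auto
      then show ?thesis by (simp add: p_def prob_eq_expectation)
    qed
    then have "(\<Sum>k<n. measure \<gamma> (?E k)) = real n * p n" by simp
    moreover have "measure \<gamma> (\<Union>k<n. ?E k) \<le> (\<Sum>k<n. measure \<gamma> (?E k))"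
      by (rule gauss.finite_measure_subadditive_finite) (use E_sets in blast)+
    moreover have "measure \<gamma> ?F \<le> (\<integral>x. (?Z x)^2 \<partial>\<gamma>) / (\<epsilon> * c n)^2"
    proof (rule integral_Markov_inequality_measure[where A = "space \<gamma>"])
      show "integrable \<gamma> (\<lambda>x. (?Z x)^2)"
      proof (rule integrable_gauss_bounded)
        fix x
        have "\<bar>?Z x\<bar> \<le> (\<Sum>k<n. c n + \<bar>b n\<bar>)"
          using tb by (intro order_trans[OF sum_abs] sum_mono order_trans[OF abs_triangle_ineq4] add_mono) auto
        then have "\<bar>?Z x\<bar>^2 \<le> (\<Sum>k<n. c n + \<bar>b n\<bar>)^2" by (intro power_mono) auto
        then show "\<bar>(?Z x)^2\<bar> \<le> (\<Sum>k<n. c n + \<bar>b n\<bar>)^2" by (simp only: power2_abs abs_power2)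
      qed measurable
    next
      show "0 < (\<epsilon> * c n)^2" using \<epsilon> cpos[OF n] by simp
    qed simp_all
    moreover have "(\<integral>x. (?Z x)^2 \<partial>\<gamma>) / (\<epsilon> * c n)^2 \<le> 480 * real n * m n / (\<epsilon> * c n)^2"
      unfolding m_def b_def using digit_sum_variance_bound[of "t n", OF tb]
      by (intro divide_right_mono) auto
    moreover have "?P n \<le> measure \<gamma> ((\<Union>k<n. ?E k) \<union> ?F)"
    proof (rule gauss.finite_measure_mono)
      show "{x \<in> space \<gamma>. \<bar>inverse (c n) * (\<Sum>k<n. g (gauss_digits x k) - b n)\<bar> > \<epsilon>} \<subseteq> (\<Union>k<n. ?E k) \<union> ?F"
      proof
        fix x assume x: "x \<in> {x \<in> space \<gamma>. \<bar>inverse (c n) * (\<Sum>k<n. g (gauss_digits x k) - b n)\<bar> > \<epsilon>}"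
        show "x \<in> (\<Union>k<n. ?E k) \<union> ?F"
        proof (cases "\<exists>k<n. \<bar>g (gauss_digits x k)\<bar> > c n")
          case False
          then have "\<bar>g (gauss_digits x k)\<bar> \<le> c n" if "k < n" for k
            using that by (meson not_less)
          then have "g (gauss_digits x k) = t n (gauss_digits x k)" if "k < n" for k
            using that by (simp add: t_def)
          then have "(\<Sum>k<n. g (gauss_digits x k) - b n) = ?Z x"
            by (intro sum.cong) auto
          with x have "\<epsilon> < \<bar>inverse (c n) * ?Z x\<bar>" by (simp only: mem_Collect_eq)
          then have "\<epsilon> * c n < \<bar>?Z x\<bar>"
            unfolding abs_eq pos_less_divide_eq[OF cpos[OF n]] .
          then have "(\<epsilon> * c n)^2 \<le> \<bar>?Z x\<bar>^2"
            using \<epsilon> cpos[OF n] by (intro power_mono less_imp_le mult_nonneg_nonneg)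
          then show ?thesis using x by (simp only: power2_abs mem_Collect_eq Un_iff simp_thms)
        next
          case True
          then obtain k where "k < n" "\<bar>g (gauss_digits x k)\<bar> > c n" by blast
          with x have "x \<in> ?E k" by (simp only: mem_Collect_eq simp_thms)
          with \<open>k < n\<close> show ?thesis by (intro UnI1 UN_I[of k]) simp_all
        qed
      qed
      show "(\<Union>k<n. ?E k) \<union> ?F \<in> sets \<gamma>"
        by (intro sets.Un sets.finite_UN F_sets E_sets finite_lessThan)
    qed
    moreover have "measure \<gamma> ((\<Union>k<n. ?E k) \<union> ?F) \<le> measure \<gamma> (\<Union>k<n. ?E k) + measure \<gamma> ?F"
      by (intro measure_Un_le sets.finite_UN F_sets E_sets finite_lessThan)
    moreover have "480 * real n * m n / (\<epsilon> * c n)^2 = 480 / \<epsilon>^2 * (real n * m n / (c n)^2)"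
      by (simp add: power_mult_distrib)
    ultimately show ?thesis by linarith
  qed
  have "(\<lambda>n. real n * p n + 480 / \<epsilon>^2 * (real n * m n / (c n)^2)) \<longlonglongrightarrow> 0 + 480 / \<epsilon>^2 * 0"
    unfolding p_def m_def t_def
    by (intro tendsto_intros tail truncated_second_moment_tendsto_0[OF r h c tail])
  then have "(\<lambda>n. real n * p n + 480 / \<epsilon>^2 * (real n * m n / (c n)^2)) \<longlonglongrightarrow> 0" by simp
  then have "?P \<longlonglongrightarrow> 0"
  proof (rule Lim_null_comparison[rotated])
    show "\<forall>\<^sub>F n in sequentially. norm (?P n) \<le> real n * p n + 480 / \<epsilon>^2 * (real n * m n / (c n)^2)"
      using eventually_ge_at_top[of 1]
      by eventually_elim (use bound in \<open>simp only: real_norm_def abs_of_nonneg measure_nonneg\<close>)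
  qed
  then show ?thesis unfolding b_def t_def .
qed

text \<open>Convergence makes the deviation probabilities at level \<open>c n / 4\<close> tend to 0,
  with \<open>A = n * b n\<close> as center, and these dominate \<open>n\<close> times the tail
  probability up to a constant.\<close>

lemma weak_law_gauss_digits_necessary:
  fixes g :: "nat \<Rightarrow> real" and b c :: "nat \<Rightarrow> real"
  assumes c: "filterlim c at_top sequentially"
    and conv: "\<And>\<epsilon>. 0 < \<epsilon> \<Longrightarrow> (\<lambda>n. measure \<gamma> {x \<in> space \<gamma>. \<bar>inverse (c n) * (\<Sum>k<n. g (gauss_digits x k) - b n)\<bar> > \<epsilon>}) \<longlonglongrightarrow> 0"
  shows "(\<lambda>n. real n * measure \<gamma> {x \<in> space \<gamma>. \<bar>g (gauss_digits x 0)\<bar> > c n}) \<longlonglongrightarrow> 0"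
proof -
  define p where "p n = measure \<gamma> {x \<in> space \<gamma>. \<bar>g (gauss_digits x 0)\<bar> > c n}" for n
  define \<delta> where "\<delta> n = measure \<gamma> {x \<in> space \<gamma>. \<bar>(\<Sum>k<n. g (gauss_digits x k)) - real n * b n\<bar> > c n / 4}" for n
  have cgt: "eventually (\<lambda>n. K < c n) sequentially" for K
    using c by (simp add: filterlim_at_top_dense)
  have \<delta>: "\<delta> \<longlonglongrightarrow> 0"
  proof (rule Lim_transform_eventually[OF conv[of "1 / 4"]])
    show "\<forall>\<^sub>F n in sequentially. measure \<gamma> {x \<in> space \<gamma>. \<bar>inverse (c n) * (\<Sum>k<n. g (gauss_digits x k) - b n)\<bar> > 1 / 4} = \<delta> n"
      using cgt[of 0]
    proof eventually_elim
      case (elim n)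
      have "\<bar>inverse (c n) * (\<Sum>k<n. g (gauss_digits x k) - b n)\<bar> =
          \<bar>(\<Sum>k<n. g (gauss_digits x k)) - real n * b n\<bar> / c n" for x
        using elim by (simp add: abs_mult sum_subtractf divide_inverse mult.commute[of _ "inverse (c n)"])
      then show ?case
        unfolding \<delta>_def by (simp only: pos_less_divide_eq[OF elim]) (simp add: mult.commute)
    qed
  qed simp
  \<comment> \<open>A bound for moderate digits that does not depend on \<open>n\<close>, from
    continuity of the measure along decreasing sets. As \<open>c\<close> tends to infinity,
    \<open>M <= c n / 4\<close> holds eventually.\<close>
  obtain M where M: "measure \<gamma> {x \<in> space \<gamma>. \<bar>g (gauss_digits x 0)\<bar> > M} \<le> 1 / 4"
  proof -
    let ?A = "\<lambda>j::nat. {x \<in> space \<gamma>. \<bar>g (gauss_digits x 0)\<bar> > real j}"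
    have "(\<lambda>j. measure \<gamma> (?A j)) \<longlonglongrightarrow> measure \<gamma> (\<Inter>j. ?A j)"
    proof (rule gauss.finite_Lim_measure_decseq)
      have "?A j \<in> sets \<gamma>" for j by (rule sets_gauss_Collect) measurable
      then show "range ?A \<subseteq> sets \<gamma>" by blast
      show "decseq ?A"
        by (rule antimonoI) force
    qed
    moreover have "(\<Inter>j. ?A j) = {}"
    proof -
      have "x \<notin> (\<Inter>j. ?A j)" for x
      proof -
        obtain j where "\<bar>g (gauss_digits x 0)\<bar> \<le> real j" using real_arch_simple by blast
        then show ?thesis by (auto intro!: exI[of _ j] simp: not_less)
      qed
      then show ?thesis by blast
    qed
    ultimately have "(\<lambda>j. measure \<gamma> (?A j)) \<longlonglongrightarrow> 0" by simp
    then have "eventually (\<lambda>j. measure \<gamma> (?A j) < 1 / 4) sequentially"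
      by (intro order_tendstoD(2)) auto
    then obtain j where "measure \<gamma> (?A j) < 1 / 4" by (auto simp: eventually_sequentially)
    then show thesis by (intro that[of "real j"]) simp
  qed
  \<comment> \<open>Since 8192 is 32 times 256, the factor \<open>1 / 128 - 32 * \<delta> n\<close>
    stays above 1/256.\<close>
  have "eventually (\<lambda>n. \<delta> n < 1 / 8192) sequentially"
    by (rule order_tendstoD(2)[OF \<delta>]) simp
  then have "eventually (\<lambda>n. norm (real n * p n) \<le> 32 * 480 * 256 * \<delta> n) sequentially"
    using cgt[of 0] cgt[of "4 * M"]
  proof eventually_elim
    case (elim n)
    have "M \<le> c n / 4" "\<delta> n \<le> 1 / 4" using elim by linarith+
    then have "real n * p n * (1 / 128 - 32 * \<delta> n) \<le> 32 * 480 * \<delta> n"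
      unfolding p_def \<delta>_def by (rule tail_le_deviation_prob[OF elim(2) _ M])
    moreover have "real n * p n * (1 / 256) \<le> real n * p n * (1 / 128 - 32 * \<delta> n)"
      using elim(1) by (intro mult_left_mono) (simp_all add: p_def)
    moreover have "norm (real n * p n) = real n * p n" by (simp add: p_def)
    ultimately show ?case by linarith
  qed
  moreover have "(\<lambda>n. 32 * 480 * 256 * \<delta> n) \<longlonglongrightarrow> 32 * 480 * 256 * 0"
    by (intro tendsto_mult tendsto_const \<delta>)
  then have "(\<lambda>n. 32 * 480 * 256 * \<delta> n) \<longlonglongrightarrow> 0" by simp
  ultimately have "(\<lambda>n. real n * p n) \<longlonglongrightarrow> 0"
    by (rule Lim_null_comparison)
  then show ?thesis unfolding p_def .
qed

section \<open>From digits of the Gauss map to continued fraction digits\<close>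

lemma AE_cf_digit: "AE x in \<gamma>. \<forall>k. cf_digit k x = gauss_digits x (k - 1)"
  using AE_gauss_irrational
proof eventually_elim
  case (elim x)
  then have "x \<in> {0<..1} - \<rat>" by auto
  then show ?case by (intro allI cf_digit_eq_gauss_digits)
qed

lemma measurable_cf_digit [measurable]: "cf_digit k \<in> measurable borel (count_space UNIV)"
proof -
  have "\<rat> \<in> sets (borel :: real measure)"
    by (rule sets.countable[OF _ countable_rat]) simp
  have "cf_digit k = (\<lambda>x. if x \<in> {0<..1} - \<rat> then gauss_digits x (k - 1) else 0)"
  proof
    fix x
    show "cf_digit k x = (if x \<in> {0<..1} - \<rat> then gauss_digits x (k - 1) else 0)"
    proof (cases "x \<in> {0<..1} - \<rat>")
      case True
      then show ?thesis by (simp only: if_True cf_digit_eq_gauss_digits)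
    next
      case False
      then show ?thesis by (simp only: cf_digit_def if_False)
    qed
  qed
  moreover have "(\<lambda>x. if x \<in> {0<..1} - \<rat> then gauss_digits x (k - 1) else 0) \<in> measurable borel (count_space UNIV)"
    by (rule measurable_If_set) (use \<open>\<rat> \<in> sets borel\<close> in simp_all)
  ultimately show ?thesis by (simp only:)
qed

theorem corollary1:
  fixes f h :: "real \<Rightarrow> real" and r :: real and c :: "nat \<Rightarrow> real"
  assumes f: "f \<in> borel_measurable borel"
    and r: "0 < r" "r < 2"
    and h: "slowly_varying h"
    and c: "\<And>n. 1 \<le> n \<Longrightarrow> c n = real n powr (1 / r) * h (real n)"
  shows
    "tendsto_in_prob gauss_measure
       (\<lambda>n x. inverse (c n) *
          (\<Sum>k = 1..n. f (real (cf_digit k x)) -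
             (\<integral>y. f (real (cf_digit k y)) *
                 indicator {z. \<bar>f (real (cf_digit k z))\<bar> \<le> c n} y \<partial>gauss_measure))) 0
     \<longleftrightarrow>
     (\<lambda>n. real n * measure gauss_measure
        {x \<in> space gauss_measure. \<bar>f (real (cf_digit 1 x))\<bar> > c n}) \<longlonglongrightarrow> 0"
proof -
  define g where "g i = f (real i)" for i :: nat
  define b where "b n = (\<integral>y. (if \<bar>g (gauss_digits y 0)\<bar> \<le> c n then g (gauss_digits y 0) else 0) \<partial>\<gamma>)" for n
  have [measurable]: "(\<lambda>x. f (real (cf_digit k x))) \<in> borel_measurable borel" for k
    by (rule measurable_compose[OF measurable_cf_digit]) simp
  \<comment> \<open>By stationarity the truncated mean does not depend on \<open>k\<close>, so a
    single constant \<open>b n\<close> centers all summands.\<close>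
  have mean: "(\<integral>y. f (real (cf_digit k y)) * indicator {z. \<bar>f (real (cf_digit k z))\<bar> \<le> c n} y \<partial>\<gamma>) = b n" for k n
  proof -
    have "(\<integral>y. f (real (cf_digit k y)) * indicator {z. \<bar>f (real (cf_digit k z))\<bar> \<le> c n} y \<partial>\<gamma>) =
        (\<integral>y. (if \<bar>g (gauss_digits y (k - 1))\<bar> \<le> c n then g (gauss_digits y (k - 1)) else 0) \<partial>\<gamma>)"
    proof (intro integral_cong_AE measurable_gauss_measure)
      show "AE y in \<gamma>. f (real (cf_digit k y)) * indicator {z. \<bar>f (real (cf_digit k z))\<bar> \<le> c n} y =
          (if \<bar>g (gauss_digits y (k - 1))\<bar> \<le> c n then g (gauss_digits y (k - 1)) else 0)"
        using AE_cf_digit by eventually_elim (auto simp: g_def)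
    qed measurable
    also have "\<dots> = b n"
      unfolding b_def
      by (rule integral_gauss_digits_shift[where C = "\<bar>c n\<bar>" and g = "\<lambda>i. if \<bar>g i\<bar> \<le> c n then g i else 0"]) auto
    finally show ?thesis .
  qed
  have sets1: "{x \<in> space \<gamma>. \<bar>f (real (cf_digit 1 x))\<bar> > c n} \<in> sets \<gamma>" for n
    by (rule sets_gauss_Collect) measurable
  have sets2: "{x \<in> space \<gamma>. \<bar>g (gauss_digits x 0)\<bar> > c n} \<in> sets \<gamma>" for n
    by (rule sets_gauss_Collect) measurable
  have sets3: "{x \<in> space \<gamma>. \<bar>inverse (c n) * (\<Sum>k = 1..n. f (real (cf_digit k x)) - b n) - 0\<bar> > \<epsilon>} \<in> sets \<gamma>" for n \<epsilon>
    by (rule sets_gauss_Collect) measurable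
  have sets4: "{x \<in> space \<gamma>. \<bar>inverse (c n) * (\<Sum>k<n. g (gauss_digits x k) - b n)\<bar> > \<epsilon>} \<in> sets \<gamma>" for n \<epsilon>
    by (rule sets_gauss_Collect) measurable
  have tail: "measure \<gamma> {x \<in> space \<gamma>. \<bar>f (real (cf_digit 1 x))\<bar> > c n} =
      measure \<gamma> {x \<in> space \<gamma>. \<bar>g (gauss_digits x 0)\<bar> > c n}" for n
  proof (rule measure_eq_AE)
    show "AE x in \<gamma>. (x \<in> {x \<in> space \<gamma>. \<bar>f (real (cf_digit 1 x))\<bar> > c n}) =
        (x \<in> {x \<in> space \<gamma>. \<bar>g (gauss_digits x 0)\<bar> > c n})"
      using AE_cf_digit by eventually_elim (simp add: g_def)
  qed (fact sets1 sets2)+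
  have dev: "measure \<gamma> {x \<in> space \<gamma>. \<bar>inverse (c n) * (\<Sum>k = 1..n. f (real (cf_digit k x)) - b n) - 0\<bar> > \<epsilon>} =
      measure \<gamma> {x \<in> space \<gamma>. \<bar>inverse (c n) * (\<Sum>k<n. g (gauss_digits x k) - b n)\<bar> > \<epsilon>}" for n \<epsilon>
  proof (rule measure_eq_AE)
    show "AE x in \<gamma>. (x \<in> {x \<in> space \<gamma>. \<bar>inverse (c n) * (\<Sum>k = 1..n. f (real (cf_digit k x)) - b n) - 0\<bar> > \<epsilon>}) =
        (x \<in> {x \<in> space \<gamma>. \<bar>inverse (c n) * (\<Sum>k<n. g (gauss_digits x k) - b n)\<bar> > \<epsilon>})"
      using AE_cf_digit
    proof eventually_elim
      case (elim x)
      have "(\<Sum>k = 1..n. f (real (cf_digit k x)) - b n) = (\<Sum>k<n. g (gauss_digits x k) - b n)"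
        using sum.atLeast1_atMost_eq[of "\<lambda>k. g (gauss_digits x (k - 1)) - b n" n] elim by (simp add: g_def)
      then show ?case by simp
    qed
  qed (fact sets3 sets4)+
  show ?thesis
    unfolding mean tail tendsto_in_prob_def dev
  proof
    assume "\<forall>\<epsilon>>0. (\<lambda>n. measure \<gamma> {x \<in> space \<gamma>. \<bar>inverse (c n) * (\<Sum>k<n. g (gauss_digits x k) - b n)\<bar> > \<epsilon>}) \<longlonglongrightarrow> 0"
    then show "(\<lambda>n. real n * measure \<gamma> {x \<in> space \<gamma>. \<bar>g (gauss_digits x 0)\<bar> > c n}) \<longlonglongrightarrow> 0"
      by (intro weak_law_gauss_digits_necessary[of c g b] regularly_varying_at_top[OF r(1) h c]) auto
  next
    assume "(\<lambda>n. real n * measure \<gamma> {x \<in> space \<gamma>. \<bar>g (gauss_digits x 0)\<bar> > c n}) \<longlonglongrightarrow> 0"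
    then show "\<forall>\<epsilon>>0. (\<lambda>n. measure \<gamma> {x \<in> space \<gamma>. \<bar>inverse (c n) * (\<Sum>k<n. g (gauss_digits x k) - b n)\<bar> > \<epsilon>}) \<longlonglongrightarrow> 0"
      unfolding b_def by (intro allI impI weak_law_gauss_digits_sufficient[OF r h c])
  qed
qed

end
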